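(* Let $a\colon[0,\infty)\to[0,\infty)$ and $b\colon[0,\infty)\to[0,\infty)$ be nondecreasing right-continuous functions, neither of which is identically zero on $[0,\infty)$. Let $\mu_a$ and $\mu_b$ be the corresponding Lebesgue--Stieltjes measures on $[0,\infty)$, defined by the conditions $\mu_a([0,x])=a(x)$ and $\mu_b([0,x])=b(x)$ for all $x\in[0,\infty)$. Suppose that $\mu_b$ is absolutely continuous with respect to $\mu_a$, with a density $\rho=\frac{d\mu_b}{d\mu_a}\colon[0,\infty)\to[0,\infty)$. Let $F_a:=\{p\in(0,\infty]\colon\mathsf{E}\,a(|T_p|)<\infty\}$ and $F_b:=\{p\in(0,\infty]\colon\mathsf{E}\,b(|T_p|)<\infty\}$. (i) If $\rho$ is nondecreasing on $[0,\infty)$, then the ratio $$\frac{\mathsf{E}\,b(|T_p|)}{\mathsf{E}\,a(|T_p|)}$$ is nonincreasing in $p\in F_a\cap F_b$; moreover, this ratio is strictly decreasing in $p\in F_a\cap F_b$ if $\rho$ is not $\mu_a$-constant on $[0,\infty)$. (ii) In particular, the ratio $\dfrac{\mathsf{E}|T_p|^t}{\mathsf{E}|T_p|^s}$ is strictly decreasing in $p\in(t,\infty]$ for any given real numbers $s$ and $t$ such that $0<s<t$.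
   Context: For real $p>0$, Student's distribution with $p$ degrees of freedom (any positive real $p$) has density $$f_p(x):=\frac{\Gamma\left(\frac{p+1}{2}\right)}{\sqrt{\pi p}\,\Gamma\left(\frac p2\right)}\left(1+\frac{x^2}{p}\right)^{-(p+1)/2},\quad x\in\mathbb{R},$$ and, by continuity, $f_\infty$ is the standard normal density. For $p\in(0,\infty]$, $T_p$ denotes any random variable with density $f_p$; in particular, $T_\infty$ is standard normal. Given a nonnegative Borel measure $\mu$ on $[0,\infty)$, a Borel set $E\subseteq[0,\infty)$, and a real-valued Borel function $h$ defined on a subset of $[0,\infty)$ containing $E$, $h$ is said to be $\mu$-constant on $E$ if $\mu(\{x\in E\colon h(x)\ne\ell\})=0$ for some $\ell\in\mathbb{R}$. *)

theory Defs
  imports "HOL-Probability.Probability"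
begin

text \<open>The parameter ranges over \<open>(0, \<infinity>]\<close>; values at \<open>p \<le> 0\<close> are irrelevant.\<close>

definition student_density :: "ereal \<Rightarrow> real \<Rightarrow> real" where
  "student_density p x =
     (if p = \<infinity> then std_normal_density x
      else let q = real_of_ereal p in
        Gamma ((q + 1) / 2) / (sqrt (pi * q) * Gamma (q / 2))
          * (1 + x\<^sup>2 / q) powr (- (q + 1) / 2))"

text \<open>
  \<open>interval_measure F\<close> gives \<open>F v - F u\<close> to \<open>{u<..v}\<close>. Extending \<open>a\<close> by \<open>0\<close> to the negative
  half-line puts an atom of mass \<open>a 0\<close> at \<open>0\<close>, so that \<open>{0..x}\<close> has measure \<open>a x\<close>.
\<close>

definition stieltjes_measure :: "(real \<Rightarrow> real) \<Rightarrow> real measure" where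
  "stieltjes_measure a =
     restrict_space (interval_measure (\<lambda>x. if x < 0 then 0 else a x)) {0..}"

lemma space_stieltjes_measure [simp]: "space (stieltjes_measure a) = {0..}"
  by (simp add: stieltjes_measure_def space_restrict_space)

lemma sets_stieltjes_measure [simp, measurable_cong]:
  "sets (stieltjes_measure a) = sets (restrict_space borel {0..})"
  by (simp add: stieltjes_measure_def sets_restrict_space)

lemma emeasure_stieltjes_measure:
  assumes nonneg: "a \<in> {0..} \<rightarrow> {0..}"
    and mono: "mono_on {0..} a"
    and rcont: "\<And>x. 0 \<le> x \<Longrightarrow> continuous (at_right x) a"
    and x: "0 \<le> x"
  shows "emeasure (stieltjes_measure a) {0..x} = ennreal (a x)"
proof -
  define F where "F = (\<lambda>x. if x < 0 then 0 else a x)"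
  have F_mono: "F u \<le> F v" if "u \<le> v" for u v
    using that nonneg mono by (auto simp: F_def mono_on_def Pi_iff)
  have F_rcont: "continuous (at_right u) F" for u
  proof (cases "u < 0")
    case True
    have "\<forall>\<^sub>F y in at_right u. F y = 0"
      unfolding eventually_at_right_field using True by (auto simp: F_def intro!: exI[of _ 0])
    then show ?thesis
      using True by (simp add: continuous_within F_def tendsto_eventually)
  next
    case False
    then have "(a \<longlongrightarrow> a u) (at_right u)"
      using rcont[of u] by (simp add: continuous_within)
    moreover have "\<forall>\<^sub>F y in at_right u. a y = F y"
      using False by (auto simp: eventually_at_right_field F_def intro!: exI[of _ "u + 1"])
    ultimately have "(F \<longlongrightarrow> a u) (at_right u)"
      by (rule Lim_transform_eventually)
    then show ?thesis
      using False by (simp add: continuous_within F_def)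
  qed
  have Ioc: "emeasure (interval_measure F) {u<..v} = ennreal (F v - F u)" if "u \<le> v" for u v
    using that F_mono F_rcont by (intro emeasure_interval_measure_Ioc) auto
  have "{-1<..- inverse (real (Suc n))} \<in> null_sets (interval_measure F)" for n
  proof -
    have "inverse (real (Suc n)) \<le> 1"
      by (simp add: field_simps)
    then have "emeasure (interval_measure F) {-1<..- inverse (real (Suc n))}
        = ennreal (F (- inverse (real (Suc n))) - F (-1))"
      by (intro Ioc) linarith
    also have "\<dots> = 0"
      by (simp add: F_def del: of_nat_Suc)
    finally show ?thesis
      by (intro null_setsI) simp_all
  qed
  then have "(\<Union>n. {-1<..- inverse (real (Suc n))}) \<in> null_sets (interval_measure F)"
    by (rule null_sets_UN)
  moreover have "{-1<..<0} \<in> sets (interval_measure F)"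
    by simp
  moreover have "{-1<..<0} \<subseteq> (\<Union>n. {-1<..- inverse (real (Suc n))})"
  proof
    fix y :: real
    assume y: "y \<in> {-1<..<0}"
    then obtain n where "inverse (real (Suc n)) < - y"
      using reals_Archimedean[of "- y"] by auto
    with y show "y \<in> (\<Union>n. {-1<..- inverse (real (Suc n))})"
      by (auto intro!: exI[of _ n])
  qed
  ultimately have null: "{-1<..<0} \<in> null_sets (interval_measure F)"
    by (rule null_sets_subset)
  have "emeasure (interval_measure F) {0..x}
      = emeasure (interval_measure F) ({-1<..x} - {-1<..<0})"
    using x by (intro arg_cong2[where f = emeasure]) auto
  also have "\<dots> = emeasure (interval_measure F) {-1<..x}"
    using null by (rule emeasure_Diff_null_set) simp
  also have "\<dots> = ennreal (a x)"
    using x by (subst Ioc) (auto simp: F_def)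
  finally show ?thesis
    unfolding stieltjes_measure_def F_def[symmetric]
    by (subst emeasure_restrict_space) auto
qed

text \<open>Intended for \<open>E\<close> and \<open>h\<close> such that \<open>{x \<in> E. h x \<noteq> l}\<close> is measurable for every \<open>l\<close>
  (\<open>emeasure\<close> is \<open>0\<close> on non-measurable sets).\<close>

definition mu_constant_on :: "real measure \<Rightarrow> (real \<Rightarrow> real) \<Rightarrow> real set \<Rightarrow> bool" where
  "mu_constant_on \<mu> h E \<longleftrightarrow> (\<exists>l. emeasure \<mu> {x \<in> E. h x \<noteq> l} = 0)"

end

theory Submission imports Defs begin

text \<open>
  By the layer-cake formula, \<open>E b(|T\<^sub>p|)\<close> is the integral of \<open>\<rho> G\<^sub>p\<close> against \<open>\<mu>\<^sub>a\<close>, where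
  \<open>G\<^sub>p u = P(|T\<^sub>p| \<ge> u)\<close>. For \<open>p < q\<close> the density ratio \<open>f\<^sub>q / f\<^sub>p\<close> is at least \<open>1\<close> at \<open>0\<close> (concavity of
  the digamma function), increases on \<open>[0, 1]\<close> and decreases on \<open>[1, \<infinity>)\<close>; this makes \<open>G\<^sub>q / G\<^sub>p\<close>
  strictly decreasing, and Chebyshev's association inequality for \<open>\<rho>\<close> and \<open>G\<^sub>q / G\<^sub>p\<close> under
  \<open>G\<^sub>p d\<mu>\<^sub>a\<close> gives (i). Part (ii) is the case \<open>d\<mu> = s u\<^sup>s\<^sup>-\<^sup>1 du\<close>, \<open>\<rho> u = (t/s) u\<^sup>t\<^sup>-\<^sup>s\<close>.
\<close>

section \<open>Strict inequalities for integrals and ratios of tail integrals\<close>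

text \<open>Otherwise the nonnegative function \<open>?d\<close> would have integral 0 and vanish
  almost everywhere, although it is positive on \<open>A\<close>, which is not a null set.\<close>

lemma set_integral_strict_mono:
  fixes f g :: "'a \<Rightarrow> real"
  assumes f: "set_integrable M A f" and g: "set_integrable M A g"
    and A: "A \<in> sets M" "emeasure M A \<noteq> 0"
    and less: "\<And>x. x \<in> A \<Longrightarrow> f x < g x"
  shows "(LINT x:A|M. f x) < (LINT x:A|M. g x)"
proof -
  let ?d = "\<lambda>x. indicator A x * (g x - f x)"
  have int: "integrable M ?d"
    using set_integral_diff(1)[OF g f] by (simp add: set_integrable_def)
  have "(LINT x:A|M. g x) - (LINT x:A|M. f x) = integral\<^sup>L M ?d"
    using set_integral_diff(2)[OF g f] by (simp add: set_lebesgue_integral_def)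
  moreover have "integral\<^sup>L M ?d \<ge> 0"
    using less by (intro integral_nonneg_AE) (auto simp: indicator_def less_imp_le)
  moreover have "integral\<^sup>L M ?d \<noteq> 0"
  proof
    assume "integral\<^sup>L M ?d = 0"
    moreover have "AE x in M. 0 \<le> ?d x"
      using less by (auto simp: indicator_def less_imp_le)
    ultimately have "AE x in M. ?d x = 0"
      using integral_nonneg_eq_0_iff_AE[OF int] by simp
    then have "AE x in M. x \<notin> A"
      by eventually_elim (use less in \<open>fastforce simp: indicator_def\<close>)
    then show False
      using A AE_iff_null_sets[OF A(1)] by (auto simp: null_sets_def)
  qed
  ultimately show ?thesis by linarith
qed

lemma emeasure_lborel_Ioi_nonzero: "emeasure lborel {u::real<..} \<noteq> 0"
proof -
  have "emeasure lborel {u<..u+1} \<le> emeasure lborel {u<..}"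
    by (intro emeasure_mono) auto
  then show ?thesis by auto
qed

lemma set_integral_Ioi_split:
  fixes f :: "real \<Rightarrow> real"
  assumes "set_integrable lborel {0<..} f" "0 \<le> u" "u \<le> v"
  shows "(LBINT x:{u<..}. f x) = (LBINT x:{u<..v}. f x) + (LBINT x:{v<..}. f x)"
proof -
  have "{u<..} = {u<..v} \<union> {v<..}" using assms by auto
  moreover have "set_integrable lborel {u<..v} f" "set_integrable lborel {v<..} f"
    using assms by (auto intro!: set_integrable_subset[OF assms(1)])
  ultimately show ?thesis
    using set_integral_Un[of "{u<..v}" "{v<..}" lborel f] by force
qed

text \<open>The point 1 separates two arguments. Up to 1, \<open>\<psi>\<close> exceeds
  \<open>\<phi>\<close> while the total masses agree, so the tail of \<open>\<psi>\<close> is the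
  smaller one and loses more mass. Beyond 1, the pointwise ratio \<open>\<psi> / \<phi>\<close>
  decreases and the ratio of tails inherits this.\<close>

lemma tail_ratio_strict_antimono:
  fixes \<phi> \<psi> :: "real \<Rightarrow> real"
  assumes int: "set_integrable lborel {0<..} \<phi>" "set_integrable lborel {0<..} \<psi>"
    and eq: "(LBINT x:{0<..}. \<phi> x) = (LBINT x:{0<..}. \<psi> x)"
    and pos: "\<And>x. 0 < x \<Longrightarrow> 0 < \<phi> x"
    and up: "\<And>x. 0 < x \<Longrightarrow> x \<le> 1 \<Longrightarrow> \<phi> x < \<psi> x"
    and down: "\<And>x y. 1 \<le> x \<Longrightarrow> x < y \<Longrightarrow> \<psi> y * \<phi> x < \<psi> x * \<phi> y"
    and uv: "0 \<le> u" "u < v"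
  shows "(LBINT x:{v<..}. \<psi> x) * (LBINT x:{u<..}. \<phi> x)
       < (LBINT x:{u<..}. \<psi> x) * (LBINT x:{v<..}. \<phi> x)"
proof -
  define P where "P u = (LBINT x:{u<..}. \<phi> x)" for u
  define Q where "Q u = (LBINT x:{u<..}. \<psi> x)" for u
  have int_phi: "set_integrable lborel A \<phi>" and int_psi: "set_integrable lborel A \<psi>"
    if "A \<in> sets borel" "A \<subseteq> {0<..}" for A
    using that by (auto intro!: set_integrable_subset[OF int(1)] set_integrable_subset[OF int(2)])
  have Ppos: "0 < P w" if "0 \<le> w" for w
  proof -
    have "(LBINT x:{w<..}. 0) < P w"
      unfolding P_def using that pos emeasure_lborel_Ioi_nonzero
      by (intro set_integral_strict_mono int_phi) (auto simp: set_integrable_def)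
    then show ?thesis by simp
  qed
  have P_split: "P u = (LBINT x:{u<..v}. \<phi> x) + P v" if "0 \<le> u" "u \<le> v" for u v
    unfolding P_def using set_integral_Ioi_split[OF int(1) that] .
  have Q_split: "Q u = (LBINT x:{u<..v}. \<psi> x) + Q v" if "0 \<le> u" "u \<le> v" for u v
    unfolding Q_def using set_integral_Ioi_split[OF int(2) that] .
  \<comment> \<open>With both tails at \<open>u\<close> split at \<open>v\<close>, it remains to
    show that \<open>Q v\<close> times the \<open>\<phi>\<close>-mass of \<open>{u<..v}\<close> is
    less than \<open>P v\<close> times its \<open>\<psi>\<close>-mass. Equal totals give
    \<open>Q v < P v\<close>.\<close>
  have low: "Q v * P u < Q u * P v" if "0 \<le> u" "u < v" "v \<le> 1" for u v
  proof -
    have less: "(LBINT x:{w<..v}. \<phi> x) < (LBINT x:{w<..v}. \<psi> x)" if "0 \<le> w" "w < v" for w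
      using that up \<open>v \<le> 1\<close> by (intro set_integral_strict_mono int_phi int_psi) auto
    have "P 0 = Q 0"
      using eq by (simp add: P_def Q_def)
    with less[of 0] P_split[of 0 v] Q_split[of 0 v] that have "Q v < P v" by simp
    moreover have "0 \<le> (LBINT x:{u<..v}. \<phi> x)"
      using that pos unfolding set_lebesgue_integral_def
      by (intro integral_nonneg_AE) (auto simp: indicator_def less_imp_le)
    ultimately have "Q v * (LBINT x:{u<..v}. \<phi> x) \<le> P v * (LBINT x:{u<..v}. \<phi> x)"
      by (intro mult_right_mono) auto
    also have "\<dots> < P v * (LBINT x:{u<..v}. \<psi> x)"
      using less[of u] that Ppos[of v] by simp
    finally show ?thesis
      using P_split[of u v] Q_split[of u v] that by (simp add: algebra_simps)
  qed
  have high: "Q v * P u < Q u * P v" if "1 \<le> u" "u < v" for u v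
  proof -
    \<comment> \<open>The ratio at \<open>v\<close> is a separating constant: \<open>\<psi>\<close>
      is below \<open>r * \<phi>\<close> to the right of \<open>v\<close> and at least
      \<open>r * \<phi>\<close> on \<open>{u<..v}\<close>.\<close>
    define r where "r = \<psi> v / \<phi> v"
    have v: "0 < \<phi> v" using pos that by simp
    have "(LBINT x:{v<..}. \<psi> x) < (LBINT x:{v<..}. r * \<phi> x)"
    proof (intro set_integral_strict_mono set_integrable_mult_right int_phi int_psi)
      show "emeasure lborel {v<..} \<noteq> 0" by (rule emeasure_lborel_Ioi_nonzero)
      show "\<psi> x < r * \<phi> x" if "x \<in> {v<..}" for x
        using down[of v x] that \<open>1 \<le> u\<close> \<open>u < v\<close> v by (simp add: r_def field_simps)
    qed (use that in auto)
    then have "Q v < r * P v" by (simp add: Q_def P_def)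
    have "(LBINT x:{u<..v}. r * \<phi> x) \<le> (LBINT x:{u<..v}. \<psi> x)"
    proof (intro set_integral_mono set_integrable_mult_right int_phi int_psi)
      show "r * \<phi> x \<le> \<psi> x" if "x \<in> {u<..v}" for x
        using down[of x v] that \<open>1 \<le> u\<close> v by (cases "x = v") (auto simp: r_def field_simps)
    qed (use that in auto)
    then have B: "r * (LBINT x:{u<..v}. \<phi> x) \<le> (LBINT x:{u<..v}. \<psi> x)" by simp
    have "(LBINT x:{u<..v}. 0) < (LBINT x:{u<..v}. \<phi> x)"
      using that pos
      by (intro set_integral_strict_mono int_phi) (auto simp: set_integrable_def)
    then have "Q v * (LBINT x:{u<..v}. \<phi> x) < (r * P v) * (LBINT x:{u<..v}. \<phi> x)"
      using \<open>Q v < r * P v\<close> by simp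
    also have "\<dots> \<le> P v * (LBINT x:{u<..v}. \<psi> x)"
      using mult_left_mono[OF B, of "P v"] Ppos[of v] that by (simp add: ac_simps)
    finally show ?thesis
      using P_split[of u v] Q_split[of u v] that by (simp add: algebra_simps)
  qed
  consider "v \<le> 1" | "1 \<le> u" | "u < 1" "1 < v" by linarith
  then have "Q v * P u < Q u * P v"
  proof cases
    case 3
    \<comment> \<open>The two regimes are chained at 1; positivity of \<open>P\<close> turns the
      products into quotients, for which the chain is transitivity.\<close>
    have "Q v * P 1 < Q 1 * P v" "Q 1 * P u < Q u * P 1"
      using high[of 1 v] low[of u 1] uv 3 by auto
    then have "Q v / P v < Q 1 / P 1" "Q 1 / P 1 < Q u / P u"
      using Ppos[of u] Ppos[of v] Ppos[of 1] uv by (auto simp: field_simps)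
    then have "Q v / P v < Q u / P u" by simp
    then show ?thesis
      using Ppos[of u] Ppos[of v] uv by (simp add: field_simps)
  qed (use low high uv in auto)
  then show ?thesis by (simp add: P_def Q_def)
qed

section \<open>The normalising constant: digamma and Gamma inequalities\<close>

text \<open>Digamma is concave on the positive reals, so its value at the midpoint of
  \<open>x\<close> and \<open>x + 1\<close> is at least the mean of the two end values. By the
  recurrence this mean is \<open>Digamma x + 1 / (2 * x)\<close>.\<close>

lemma Digamma_add_half_ge:
  fixes x :: real
  assumes "0 < x"
  shows "1 / (2 * x) \<le> Digamma (x + 1/2) - Digamma x"
proof -
  have "concave_on {0<..} (Digamma :: real \<Rightarrow> real)"
  proof (rule f''_le0_imp_concave)
    fix y :: real assume "y \<in> {0<..}"
    then have y: "y \<notin> \<int>\<^sub>\<le>\<^sub>0" "0 < y" by (auto elim!: nonpos_Ints_cases)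
    show "(Polygamma 0 has_real_derivative Polygamma 1 y) (at y)"
      using y by (auto intro!: derivative_eq_intros)
    show "(Polygamma 1 has_real_derivative Polygamma 2 y) (at y)"
      using y by (auto intro!: derivative_eq_intros simp: numeral_2_eq_2)
    show "Polygamma 2 y \<le> 0"
      using Polygamma_real_even_neg[of y 2] y by simp
  qed simp
  from concave_onD[OF this, of "1/2" x "x + 1"] assms
  have "(Digamma x + Digamma (x + 1)) / 2 \<le> Digamma (x + 1/2)"
    by (simp add: field_simps)
  then have "(Digamma x + (Digamma x + 1 / x)) / 2 \<le> Digamma (x + 1/2)"
    using assms by (simp only: Digamma_plus1)
  \<comment> \<open>To be read with \<open>d = Digamma x\<close>, \<open>k = 1 / x\<close> and
    \<open>e = Digamma (x + 1/2)\<close>.\<close>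
  moreover have "k / 2 \<le> e - d" if "(d + (d + k)) / 2 \<le> e" for d e k :: real
    using that by simp
  ultimately have "(1 / x) / 2 \<le> Digamma (x + 1/2) - Digamma x"
    by blast
  then show ?thesis by (simp only: divide_divide_eq_left mult.commute)
qed

text \<open>The logarithm of the quotient has derivative
  \<open>Digamma (z + 1/2) - Digamma z - 1 / (2 * z)\<close>, which is nonnegative by
  \<open>Digamma_add_half_ge\<close>. At half the degrees of freedom the quotient is the density at
  0 up to a constant factor.\<close>

lemma Gamma_half_ratio_mono:
  fixes x y :: real
  assumes "0 < x" "x \<le> y"
  shows "Gamma (x + 1/2) / (sqrt x * Gamma x) \<le> Gamma (y + 1/2) / (sqrt y * Gamma y)"
proof -
  define h where "h x = ln_Gamma (x + 1/2) - ln_Gamma x - ln x / 2" for x :: real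
  have h: "exp (h x) = Gamma (x + 1/2) / (sqrt x * Gamma x)" if "0 < x" for x
    using that by (simp add: h_def exp_diff ln_Gamma_real_pos ln_sqrt[symmetric])
  have "h x \<le> h y"
  proof (rule DERIV_nonneg_imp_nondecreasing[OF assms(2)])
    fix z assume "x \<le> z" "z \<le> y"
    with assms have z: "0 < z" by simp
    have "(h has_real_derivative Digamma (z + 1/2) - Digamma z - 1 / (2 * z)) (at z)"
      unfolding h_def using z by (auto intro!: derivative_eq_intros)
    then show "\<exists>d. (h has_real_derivative d) (at z) \<and> 0 \<le> d"
      using Digamma_add_half_ge[OF z] by (intro exI conjI) auto
  qed
  with h[of x] h[of y] assms show ?thesis by (metis exp_le_cancel_iff less_le_trans)
qed

text \<open>Log-convexity of Gamma at the midpoint of \<open>x\<close> and \<open>x + 1\<close>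
  bounds the square of \<open>Gamma (x + 1/2)\<close> by \<open>x\<close> times the square of
  \<open>Gamma x\<close>. This compares finite degrees of freedom with the normal case without
  passing to a limit.\<close>

lemma Gamma_half_ratio_le_1:
  fixes x :: real
  assumes "0 < x"
  shows "Gamma (x + 1/2) / (sqrt x * Gamma x) \<le> 1"
proof -
  have "(ln \<circ> Gamma) ((1 - 1/2) *\<^sub>R x + (1/2) *\<^sub>R (x + 1))
      \<le> (1 - 1/2) * (ln \<circ> Gamma) x + 1/2 * (ln \<circ> Gamma) (x + 1)"
    using assms by (intro convex_onD[OF log_convex_Gamma_real]) auto
  moreover have "(1 - 1/2) *\<^sub>R x + (1/2) *\<^sub>R (x + 1) = x + 1/2"
    by (simp add: field_simps)
  moreover have "Gamma (x + 1) = x * Gamma x"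
    using assms by (auto intro!: Gamma_plus1 elim!: nonpos_Ints_cases)
  ultimately have "ln (Gamma (x + 1/2)) \<le> (ln (Gamma x) + ln (x * Gamma x)) / 2"
    by simp
  also have "\<dots> = ln (sqrt x * Gamma x)"
    using assms by (simp add: ln_mult ln_sqrt less_imp_neq[symmetric])
  finally have "Gamma (x + 1/2) \<le> sqrt x * Gamma x"
    using assms by simp
  then show ?thesis using assms by (simp add: field_simps)
qed

section \<open>Logarithmic kernels and the density ratio\<close>

text \<open>The variable of \<open>log_kernel\<close> is \<open>y = x\<^sup>2\<close>, the square of the argument of the density.\<close>

definition log_kernel :: "ereal \<Rightarrow> real \<Rightarrow> real" where
  "log_kernel p y = (if p = \<infinity> then - y / 2
     else - (real_of_ereal p + 1) / 2 * ln (1 + y / real_of_ereal p))"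

lemma log_kernel_0 [simp]: "log_kernel p 0 = 0"
  by (simp add: log_kernel_def)

lemma student_density_eq_exp_log_kernel:
  assumes "0 < p"
  shows "student_density p x = student_density p 0 * exp (log_kernel p (x\<^sup>2))"
proof (cases p)
  case (real q)
  with assms have "0 < 1 + x\<^sup>2 / q"
    by (auto intro!: add_pos_nonneg)
  with real assms show ?thesis
    by (simp add: student_density_def log_kernel_def powr_def Let_def)
next
  case PInf
  then show ?thesis
    by (simp add: student_density_def log_kernel_def std_normal_density_def)
qed (use assms in auto)

text \<open>The normal value is factored out, so that comparing densities at 0 means comparing two
  Gamma quotients, or one of them with 1.\<close>

lemma student_density_0:
  "student_density \<infinity> 0 = 1 / sqrt (2 * pi)"
  "0 < q \<Longrightarrow> student_density (ereal q) 0 =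
     1 / sqrt (2 * pi) * (Gamma (q / 2 + 1/2) / (sqrt (q / 2) * Gamma (q / 2)))"
  by (auto simp: student_density_def std_normal_density_def Let_def real_sqrt_mult
      real_sqrt_divide add_divide_distrib)

lemma student_density_0_mono:
  assumes "0 < p" "p \<le> q"
  shows "student_density p 0 \<le> student_density q 0"
proof (cases p; cases q)
  fix r s assume "p = ereal r" "q = ereal s"
  with assms have rs: "0 < r" "0 < s" "0 < r / 2" "r / 2 \<le> s / 2" by auto
  show ?thesis
    unfolding \<open>p = ereal r\<close> \<open>q = ereal s\<close> student_density_0(2)[OF rs(1)] student_density_0(2)[OF rs(2)]
    by (intro mult_left_mono Gamma_half_ratio_mono rs) simp
next
  fix r assume "p = ereal r" "q = \<infinity>"
  with assms have r: "0 < r" by auto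
  then have "1 / sqrt (2 * pi) * (Gamma (r / 2 + 1/2) / (sqrt (r / 2) * Gamma (r / 2)))
      \<le> 1 / sqrt (2 * pi) * 1"
    by (intro mult_left_mono Gamma_half_ratio_le_1) auto
  then show ?thesis
    unfolding \<open>p = ereal r\<close> \<open>q = \<infinity>\<close> student_density_0(1) student_density_0(2)[OF r] by simp
qed (use assms in auto)

lemma student_density_pos:
  assumes "0 < p"
  shows "0 < student_density p x"
proof -
  have "0 < student_density p 0"
    using assms by (cases p) (auto simp: student_density_0)
  then show ?thesis
    by (subst student_density_eq_exp_log_kernel[OF assms]) simp
qed

text \<open>For finite \<open>p\<close> this equals \<open>- (p + 1) / (2 * (p + y))\<close>. The
  form chosen confines \<open>p\<close> to the factor \<open>1 / (p + y)\<close>, which becomes 0 at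
  \<open>\<infinity>\<close>, and exhibits the factor \<open>1 - y\<close> that decides the sign of
  differences.\<close>

definition log_kernel_deriv :: "ereal \<Rightarrow> real \<Rightarrow> real" where
  "log_kernel_deriv p y = - (1 + (1 - y) * (if p = \<infinity> then 0 else 1 / (real_of_ereal p + y))) / 2"

lemma has_derivative_log_kernel:
  assumes "0 < p" "0 \<le> y"
  shows "(log_kernel p has_real_derivative log_kernel_deriv p y) (at y)"
proof (cases p)
  case (real q)
  with assms have "0 < q" "0 < 1 + y / q"
    by (auto intro!: add_pos_nonneg)
  moreover have "log_kernel p = (\<lambda>y. - (q + 1) / 2 * ln (1 + y / q))"
    using real by (simp add: log_kernel_def fun_eq_iff)
  ultimately show ?thesis
    using real assms
    by (auto intro!: derivative_eq_intros simp: log_kernel_deriv_def field_simps)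
next
  case PInf
  then have "log_kernel p = (\<lambda>y. - y / 2)"
    by (simp add: log_kernel_def fun_eq_iff)
  with PInf show ?thesis
    by (auto intro!: derivative_eq_intros simp: log_kernel_deriv_def)
qed (use assms in auto)

text \<open>The two derivatives differ by \<open>(1 - y) * (\<kappa> p - \<kappa> q) / 2\<close>,
  and \<open>\<kappa>\<close> strictly decreases in the degrees of freedom, including the step to
  its value 0 at \<open>\<infinity>\<close>.\<close>

lemma log_kernel_deriv_diff:
  assumes "0 < p" "p < q" "0 \<le> y"
  shows "y < 1 \<Longrightarrow> log_kernel_deriv p y < log_kernel_deriv q y"
    and "1 < y \<Longrightarrow> log_kernel_deriv q y < log_kernel_deriv p y"
proof -
  define \<kappa> where "\<kappa> p = (if p = \<infinity> then 0 else 1 / (real_of_ereal p + y))" for p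
  have "\<kappa> q < \<kappa> p"
    using assms by (cases p; cases q) (auto simp: \<kappa>_def frac_less2 add_pos_nonneg)
  moreover have "log_kernel_deriv q y - log_kernel_deriv p y = (1 - y) * (\<kappa> p - \<kappa> q) / 2"
    by (simp add: log_kernel_deriv_def \<kappa>_def field_simps)
  ultimately show "y < 1 \<Longrightarrow> log_kernel_deriv p y < log_kernel_deriv q y"
    and "1 < y \<Longrightarrow> log_kernel_deriv q y < log_kernel_deriv p y"
    by (smt (verit) mult_pos_pos mult_neg_pos divide_pos_pos divide_neg_pos)+
qed

text \<open>Up to an additive constant, this difference is the logarithm of the density ratio at
  \<open>sqrt y\<close>; its derivative changes sign only at 1.\<close>

lemma log_kernel_diff_unimodal:
  assumes pq: "0 < p" "p < q"
  shows "0 \<le> y \<Longrightarrow> y < z \<Longrightarrow> z \<le> 1 \<Longrightarrow>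
      log_kernel q y - log_kernel p y < log_kernel q z - log_kernel p z"
    and "1 \<le> y \<Longrightarrow> y < z \<Longrightarrow>
      log_kernel q z - log_kernel p z < log_kernel q y - log_kernel p y"
proof -
  have "0 < q" using pq by simp
  then have D: "((\<lambda>y. log_kernel q y - log_kernel p y) has_real_derivative
      log_kernel_deriv q y - log_kernel_deriv p y) (at y)" if "0 \<le> y" for y
    using that pq by (intro DERIV_diff has_derivative_log_kernel)
  then have cont: "continuous_on {y..z} (\<lambda>y. log_kernel q y - log_kernel p y)" if "0 \<le> y" for y z
    using that
    by (auto intro!: continuous_at_imp_continuous_on DERIV_isCont[OF D])
  show "log_kernel q y - log_kernel p y < log_kernel q z - log_kernel p z"
    if "0 \<le> y" "y < z" "z \<le> 1"
  proof (rule DERIV_pos_imp_increasing_open[OF \<open>y < z\<close>])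
    fix w assume "y < w" "w < z"
    with that D[of w] log_kernel_deriv_diff(1)[OF pq, of w]
    show "\<exists>d. ((\<lambda>y. log_kernel q y - log_kernel p y) has_real_derivative d) (at w) \<and> 0 < d"
      by (intro exI conjI) auto
  qed (use that cont in auto)
  show "log_kernel q z - log_kernel p z < log_kernel q y - log_kernel p y"
    if "1 \<le> y" "y < z"
  proof (rule DERIV_neg_imp_decreasing_open[OF \<open>y < z\<close>])
    fix w assume "y < w" "w < z"
    with that D[of w] log_kernel_deriv_diff(2)[OF pq, of w]
    show "\<exists>d. ((\<lambda>y. log_kernel q y - log_kernel p y) has_real_derivative d) (at w) \<and> d < 0"
      by (intro exI conjI) auto
  qed (use that cont in auto)
qed

text \<open>Two effects combine: the density at 0 does not decrease with the degrees of freedom, and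
  the log kernels, equal at 0, separate strictly on the way to \<open>x\<^sup>2\<close>.\<close>

lemma student_density_less:
  assumes "0 < p" "p < q" "0 < x" "x \<le> 1"
  shows "student_density p x < student_density q x"
proof -
  have "0 < q" using assms by simp
  have "log_kernel q 0 - log_kernel p 0 < log_kernel q (x\<^sup>2) - log_kernel p (x\<^sup>2)"
    using assms by (intro log_kernel_diff_unimodal(1)) (auto simp: power_le_one)
  then have "log_kernel p (x\<^sup>2) < log_kernel q (x\<^sup>2)"
    by simp
  moreover have "student_density p 0 \<le> student_density q 0"
    using assms by (intro student_density_0_mono) auto
  ultimately show ?thesis
    unfolding student_density_eq_exp_log_kernel[OF \<open>0 < p\<close>, of x]
      student_density_eq_exp_log_kernel[OF \<open>0 < q\<close>, of x]
    using student_density_pos[OF \<open>0 < p\<close>, of 0]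
    by (intro mult_le_less_imp_less) auto
qed

text \<open>The normalising constants enter both products alike, so only the log kernels at
  \<open>x\<^sup>2\<close> and \<open>y\<^sup>2\<close> matter.\<close>

lemma student_density_ratio_strict_antimono:
  assumes "0 < p" "p < q" "1 \<le> x" "x < y"
  shows "student_density q y * student_density p x < student_density q x * student_density p y"
proof -
  have "0 < q" using assms by simp
  have "1 \<le> x\<^sup>2" "x\<^sup>2 < y\<^sup>2"
    using assms by (auto simp: power_strict_mono)
  then have "log_kernel q (y\<^sup>2) - log_kernel p (y\<^sup>2) < log_kernel q (x\<^sup>2) - log_kernel p (x\<^sup>2)"
    using assms by (intro log_kernel_diff_unimodal(2)) auto
  then have "exp (log_kernel q (y\<^sup>2)) * exp (log_kernel p (x\<^sup>2))
      < exp (log_kernel q (x\<^sup>2)) * exp (log_kernel p (y\<^sup>2))"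
    by (simp flip: exp_add)
  then have "(student_density q 0 * student_density p 0)
        * (exp (log_kernel q (y\<^sup>2)) * exp (log_kernel p (x\<^sup>2)))
      < (student_density q 0 * student_density p 0)
        * (exp (log_kernel q (x\<^sup>2)) * exp (log_kernel p (y\<^sup>2)))"
    using student_density_pos[OF \<open>0 < p\<close>, of 0] student_density_pos[OF \<open>0 < q\<close>, of 0]
    by (intro mult_strict_left_mono) auto
  then show ?thesis
    unfolding student_density_eq_exp_log_kernel[OF \<open>0 < p\<close>, of x]
      student_density_eq_exp_log_kernel[OF \<open>0 < p\<close>, of y]
      student_density_eq_exp_log_kernel[OF \<open>0 < q\<close>, of x]
      student_density_eq_exp_log_kernel[OF \<open>0 < q\<close>, of y]
    by (simp only: mult_ac)
qed

lemma borel_measurable_student_density [measurable]: "student_density p \<in> borel_measurable borel"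
proof -
  have *: "student_density p = (\<lambda>x. if p = \<infinity> then std_normal_density x
      else Gamma ((real_of_ereal p + 1) / 2) / (sqrt (pi * real_of_ereal p) * Gamma (real_of_ereal p / 2))
        * (1 + x\<^sup>2 / real_of_ereal p) powr (- (real_of_ereal p + 1) / 2))"
    by (rule ext) (simp only: student_density_def Let_def)
  show ?thesis
    unfolding * by measurable
qed

lemma student_density_minus: "student_density p (- x) = student_density p x"
  by (simp only: student_density_def std_normal_density_def power2_minus)

section \<open>The law of the absolute value and the layer-cake formula\<close>

lemma nn_integral_even:
  fixes f :: "real \<Rightarrow> ennreal"
  assumes [measurable]: "f \<in> borel_measurable borel" and even: "\<And>x. f (- x) = f x"
  shows "(\<integral>\<^sup>+x. f x \<partial>lborel) = 2 * (\<integral>\<^sup>+x. f x * indicator {0<..} x \<partial>lborel)"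
proof -
  have "(\<integral>\<^sup>+x. f x \<partial>lborel) =
      (\<integral>\<^sup>+x. f x * indicator {0<..} x + f x * indicator {..<0} x \<partial>lborel)"
    using AE_lborel_singleton[of 0]
    by (intro nn_integral_cong_AE) (auto simp: indicator_def elim!: eventually_mono)
  also have "\<dots> = (\<integral>\<^sup>+x. f x * indicator {0<..} x \<partial>lborel) + (\<integral>\<^sup>+x. f x * indicator {..<0} x \<partial>lborel)"
    by (intro nn_integral_add) auto
  also have "(\<integral>\<^sup>+x. f x * indicator {..<0} x \<partial>lborel) =
      (\<integral>\<^sup>+x. f (- x) * indicator {..<0} (- x) \<partial>lborel)"
    using nn_integral_real_affine[of "\<lambda>x. f x * indicator {..<0} x" "-1" 0] by simp
  also have "\<dots> = (\<integral>\<^sup>+x. f x * indicator {0<..} x \<partial>lborel)"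
    using even by (intro nn_integral_cong) (auto simp: indicator_def)
  finally show ?thesis by (simp add: mult_2)
qed

lemma Icc_sets_restrict_space:
  fixes x :: real
  assumes "sets \<mu> = sets (restrict_space borel {0..})"
  shows "{0..x} \<in> sets \<mu>"
  by (auto simp: assms sets_restrict_space intro!: image_eqI[of _ _ "{0..x}"])

text \<open>For \<open>u \<ge> 0\<close> this is the probability that
  \<open>\<bar>T\<bar> \<ge> u\<close>; the factor 2 accounts for the negative half-line. As an
  integral of the density it does not depend on the probability space carrying the variable.\<close>

definition student_tail :: "ereal \<Rightarrow> real \<Rightarrow> real" where
  "student_tail p u = 2 * (LBINT x:{u<..}. student_density p x)"

text \<open>A single \<open>p\<close> is fixed, so that variables for different \<open>p\<close> may
  live on different probability spaces.\<close>

locale student_variable = prob_space M for M :: "'w measure" +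
  fixes p :: ereal and T :: "'w \<Rightarrow> real"
  assumes p_pos: "0 < p"
    and distributed_T: "distributed M lborel T (\<lambda>x. ennreal (student_density p x))"
begin

lemma measurable_T [measurable]: "T \<in> borel_measurable M"
  using distributed_measurable[OF distributed_T] by simp

lemma nn_integral_abs_T:
  assumes [measurable]: "h \<in> borel_measurable borel"
  shows "(\<integral>\<^sup>+\<omega>. h \<bar>T \<omega>\<bar> \<partial>M) =
    2 * (\<integral>\<^sup>+x. ennreal (student_density p x) * h x * indicator {0<..} x \<partial>lborel)"
proof -
  have "(\<integral>\<^sup>+\<omega>. h \<bar>T \<omega>\<bar> \<partial>M) = (\<integral>\<^sup>+x. ennreal (student_density p x) * h \<bar>x\<bar> \<partial>lborel)"
    by (subst distributed_nn_integral[OF distributed_T]) auto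
  also have "\<dots> = 2 * (\<integral>\<^sup>+x. ennreal (student_density p x) * h \<bar>x\<bar> * indicator {0<..} x \<partial>lborel)"
    by (intro nn_integral_even) (auto simp: student_density_minus)
  also have "(\<integral>\<^sup>+x. ennreal (student_density p x) * h \<bar>x\<bar> * indicator {0<..} x \<partial>lborel) =
      (\<integral>\<^sup>+x. ennreal (student_density p x) * h x * indicator {0<..} x \<partial>lborel)"
    by (intro nn_integral_cong) (auto simp: indicator_def)
  finally show ?thesis .
qed

text \<open>The normalisation of the density is read off from the total mass of \<open>M\<close>,
  with the constant function 1 as \<open>h\<close>.\<close>

lemma nn_integral_student_density_half:
  "2 * (\<integral>\<^sup>+x. ennreal (student_density p x) * indicator {0<..} x \<partial>lborel) = 1"
  using nn_integral_abs_T[of "\<lambda>_. 1"] by (simp add: emeasure_space_1)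

lemma set_integrable_student_density: "set_integrable lborel {0<..} (student_density p)"
proof -
  have "(\<integral>\<^sup>+x. ennreal (indicator {0<..} x * student_density p x) \<partial>lborel) =
      (\<integral>\<^sup>+x. ennreal (student_density p x) * indicator {0<..} x \<partial>lborel)"
    by (intro nn_integral_cong) (auto simp: indicator_def)
  also have "\<dots> < \<infinity>"
    using nn_integral_student_density_half
    by (auto simp: less_top[symmetric] ennreal_mult_eq_top_iff)
  finally show ?thesis
    unfolding set_integrable_def real_scaleR_def
    using student_density_pos[OF p_pos]
    by (intro integrableI_nonneg) (auto simp: indicator_def less_imp_le)
qed

lemma emeasure_abs_T_ge:
  assumes "0 \<le> u"
  shows "emeasure M {\<omega> \<in> space M. u \<le> \<bar>T \<omega>\<bar>} = ennreal (student_tail p u)"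
proof -
  have int: "integrable lborel (\<lambda>x. indicator {u<..} x * student_density p x)"
    using set_integrable_subset[OF set_integrable_student_density, of "{u<..}"] assms
    by (simp add: set_integrable_def)
  have "emeasure M {\<omega> \<in> space M. u \<le> \<bar>T \<omega>\<bar>} = (\<integral>\<^sup>+\<omega>. indicator {u..} \<bar>T \<omega>\<bar> \<partial>M)"
  proof -
    have "(\<integral>\<^sup>+\<omega>. indicator {u..} \<bar>T \<omega>\<bar> \<partial>M) =
        (\<integral>\<^sup>+\<omega>. indicator {\<omega> \<in> space M. u \<le> \<bar>T \<omega>\<bar>} \<omega> \<partial>M)"
      by (intro nn_integral_cong) (auto simp: indicator_def)
    then show ?thesis by simp
  qed
  also have "\<dots> =
      2 * (\<integral>\<^sup>+x. ennreal (student_density p x) * indicator {u..} x * indicator {0<..} x \<partial>lborel)"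
    by (rule nn_integral_abs_T) simp
  \<comment> \<open>The closed half-line becomes the open one in \<open>student_tail\<close>: the
    point \<open>u\<close> is a Lebesgue null set.\<close>
  also have "(\<integral>\<^sup>+x. ennreal (student_density p x) * indicator {u..} x * indicator {0<..} x \<partial>lborel)
      = (\<integral>\<^sup>+x. ennreal (indicator {u<..} x * student_density p x) \<partial>lborel)"
    using AE_lborel_singleton[of u] assms
    by (intro nn_integral_cong_AE) (auto simp: indicator_def elim!: eventually_mono)
  also have "\<dots> = ennreal (LBINT x:{u<..}. student_density p x)"
    using student_density_pos[OF p_pos]
    by (subst nn_integral_eq_integral[OF int])
       (auto simp: indicator_def less_imp_le set_lebesgue_integral_def)
  also have "2 * \<dots> = ennreal (student_tail p u)"
    by (simp add: student_tail_def ennreal_mult')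
  finally show ?thesis .
qed

lemma student_tail_0: "student_tail p 0 = 1"
proof -
  have "{\<omega> \<in> space M. 0 \<le> \<bar>T \<omega>\<bar>} = space M" by auto
  with emeasure_abs_T_ge[of 0] show ?thesis
    by (metis emeasure_space_1 ennreal_eq_1 order_refl)
qed

lemma student_tail_pos:
  assumes "0 \<le> u"
  shows "0 < student_tail p u"
proof -
  have "(LBINT x:{u<..}. 0) < (LBINT x:{u<..}. student_density p x)"
    using assms student_density_pos[OF p_pos] emeasure_lborel_Ioi_nonzero
    by (intro set_integral_strict_mono set_integrable_subset[OF set_integrable_student_density])
       (auto simp: set_integrable_def)
  then show ?thesis by (simp add: student_tail_def)
qed

text \<open>On the nonnegative half-line the tail agrees with \<open>H\<close>, which is antitone on
  the whole line and hence Borel.\<close>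

lemma borel_measurable_student_tail:
  assumes "sets \<mu> = sets (restrict_space borel {0..})"
  shows "student_tail p \<in> borel_measurable \<mu>"
proof -
  define H where "H u = measure M {\<omega> \<in> space M. u \<le> \<bar>T \<omega>\<bar>}" for u
  have "mono (\<lambda>u. - H u)"
    unfolding H_def by (intro monoI) (auto intro!: finite_measure_mono)
  then have "H \<in> borel_measurable borel"
    using borel_measurable_mono borel_measurable_uminus_eq by blast
  then have "H \<in> borel_measurable (restrict_space borel {0..})"
    by (simp add: measurable_restrict_space1)
  moreover have "H u = student_tail p u" if "0 \<le> u" for u
    using emeasure_abs_T_ge[OF that] student_tail_pos[OF that]
    by (simp add: H_def measure_def less_imp_le)
  ultimately have "student_tail p \<in> borel_measurable (restrict_space borel {0..})"
    by (subst measurable_cong[where g = H]) (auto simp: space_restrict_space)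
  then show ?thesis
    by (simp add: measurable_cong_sets[OF assms refl])
qed

text \<open>The value \<open>a \<bar>T \<omega>\<bar>\<close> is the \<open>\<mu>\<close>-integral
  over \<open>u\<close> of the indicator of \<open>u \<le> \<bar>T \<omega>\<bar>\<close>. Tonelli
  exchanges the two integrals, and the inner one becomes a tail probability.\<close>

lemma nn_integral_layer_cake:
  assumes sets: "sets \<mu> = sets (restrict_space borel {0..})"
    and a: "\<And>x. 0 \<le> x \<Longrightarrow> emeasure \<mu> {0..x} = ennreal (a x)"
  shows "(\<integral>\<^sup>+\<omega>. ennreal (a \<bar>T \<omega>\<bar>) \<partial>M) = (\<integral>\<^sup>+u. ennreal (student_tail p u) \<partial>\<mu>)"
proof -
  have space: "space \<mu> = {0..}"
    using sets_eq_imp_space_eq[OF sets] by (simp add: space_restrict_space)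
  have Icc: "{0..x} \<in> sets \<mu>" for x
    by (rule Icc_sets_restrict_space[OF sets])
  interpret \<mu>: sigma_finite_measure \<mu>
  proof
    \<comment> \<open>Sigma-finiteness: the intervals \<open>{0..real n}\<close> exhaust the space
      and have finite mass \<open>a (real n)\<close>.\<close>
    show "\<exists>A. countable A \<and> A \<subseteq> sets \<mu> \<and> \<Union>A = space \<mu> \<and> (\<forall>a\<in>A. emeasure \<mu> a \<noteq> \<infinity>)"
      using Icc real_arch_simple
      by (intro exI[of _ "range (\<lambda>n. {0..real n})"]) (auto simp: a space)
  qed
  interpret pair_sigma_finite M \<mu> ..
  have "(\<lambda>u. u) \<in> borel_measurable \<mu>"
    by (simp add: measurable_cong_sets[OF sets refl] measurable_restrict_space1)
  then have [measurable]: "snd \<in> borel_measurable (M \<Otimes>\<^sub>M \<mu>)"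
    using measurable_compose[OF measurable_snd] by fastforce
  have meas: "(\<lambda>(\<omega>, u). if u \<le> \<bar>T \<omega>\<bar> then 1 else 0 :: ennreal) \<in> borel_measurable (M \<Otimes>\<^sub>M \<mu>)"
    unfolding case_prod_beta by measurable
  have "(\<integral>\<^sup>+\<omega>. ennreal (a \<bar>T \<omega>\<bar>) \<partial>M) = (\<integral>\<^sup>+\<omega>. (\<integral>\<^sup>+u. (if u \<le> \<bar>T \<omega>\<bar> then 1 else 0) \<partial>\<mu>) \<partial>M)"
  proof (intro nn_integral_cong)
    fix \<omega>
    have "(\<integral>\<^sup>+u. (if u \<le> \<bar>T \<omega>\<bar> then 1 else 0) \<partial>\<mu>) = (\<integral>\<^sup>+u. indicator {0..\<bar>T \<omega>\<bar>} u \<partial>\<mu>)"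
      by (intro nn_integral_cong) (auto simp: indicator_def space)
    also have "\<dots> = ennreal (a \<bar>T \<omega>\<bar>)"
      using Icc a by simp
    finally show "ennreal (a \<bar>T \<omega>\<bar>) = (\<integral>\<^sup>+u. (if u \<le> \<bar>T \<omega>\<bar> then 1 else 0) \<partial>\<mu>)" by simp
  qed
  also have "\<dots> = (\<integral>\<^sup>+u. (\<integral>\<^sup>+\<omega>. (if u \<le> \<bar>T \<omega>\<bar> then 1 else 0) \<partial>M) \<partial>\<mu>)"
    by (rule Fubini'[OF meas, symmetric])
  also have "\<dots> = (\<integral>\<^sup>+u. ennreal (student_tail p u) \<partial>\<mu>)"
  proof (intro nn_integral_cong)
    fix u assume "u \<in> space \<mu>"
    then have "0 \<le> u" by (simp add: space)
    have "(\<integral>\<^sup>+\<omega>. (if u \<le> \<bar>T \<omega>\<bar> then 1 else 0) \<partial>M) =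
        (\<integral>\<^sup>+\<omega>. indicator {\<omega> \<in> space M. u \<le> \<bar>T \<omega>\<bar>} \<omega> \<partial>M)"
      by (intro nn_integral_cong) (auto simp: indicator_def)
    then show "(\<integral>\<^sup>+\<omega>. (if u \<le> \<bar>T \<omega>\<bar> then 1 else 0) \<partial>M) = ennreal (student_tail p u)"
      using emeasure_abs_T_ge[OF \<open>0 \<le> u\<close>] by simp
  qed
  finally show ?thesis .
qed

text \<open>The layer-cake formula is applied to the measure with density \<open>\<rho>\<close> over
  \<open>\<mu>\<close>, whose distribution function is \<open>b\<close>; the finite expectation then
  permits real-valued integrals.\<close>

lemma expectation_layer_cake:
  assumes sets: "sets \<mu> = sets (restrict_space borel {0..})"
    and [measurable]: "\<rho> \<in> borel_measurable \<mu>"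
    and \<rho>_nonneg: "\<And>x. 0 \<le> x \<Longrightarrow> 0 \<le> \<rho> x"
    and b: "\<And>x. 0 \<le> x \<Longrightarrow> emeasure (density \<mu> (\<lambda>x. ennreal (\<rho> x))) {0..x} = ennreal (b x)"
    and b_nonneg: "\<And>x. 0 \<le> x \<Longrightarrow> 0 \<le> b x"
    and fin: "(\<integral>\<^sup>+\<omega>. ennreal (b \<bar>T \<omega>\<bar>) \<partial>M) < \<infinity>"
  shows "integrable \<mu> (\<lambda>u. \<rho> u * student_tail p u)"
    and "(\<integral>\<omega>. b \<bar>T \<omega>\<bar> \<partial>M) = (\<integral>u. \<rho> u * student_tail p u \<partial>\<mu>)"
proof -
  let ?\<nu> = "density \<mu> (\<lambda>x. ennreal (\<rho> x))"
  note [measurable] = borel_measurable_student_tail[OF sets]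
  have space: "space \<mu> = {0..}"
    using sets_eq_imp_space_eq[OF sets] by (simp add: space_restrict_space)
  have nonneg: "0 \<le> \<rho> u * student_tail p u" if "0 \<le> u" for u
    using \<rho>_nonneg[OF that] student_tail_pos[OF that] by simp
  have "(\<integral>\<^sup>+\<omega>. ennreal (b \<bar>T \<omega>\<bar>) \<partial>M) = (\<integral>\<^sup>+u. ennreal (student_tail p u) \<partial>?\<nu>)"
    by (rule nn_integral_layer_cake) (simp_all only: sets_density sets b)
  also have "\<dots> = (\<integral>\<^sup>+u. ennreal (\<rho> u) * ennreal (student_tail p u) \<partial>\<mu>)"
    by (intro nn_integral_density) auto
  also have "\<dots> = (\<integral>\<^sup>+u. ennreal (\<rho> u * student_tail p u) \<partial>\<mu>)"
  proof (intro nn_integral_cong)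
    fix u assume "u \<in> space \<mu>"
    then have "0 \<le> \<rho> u" "0 \<le> student_tail p u"
      using \<rho>_nonneg[of u] student_tail_pos[of u] by (auto simp: space)
    then show "ennreal (\<rho> u) * ennreal (student_tail p u) = ennreal (\<rho> u * student_tail p u)"
      by (rule ennreal_mult[symmetric])
  qed
  finally have eq: "(\<integral>\<^sup>+\<omega>. ennreal (b \<bar>T \<omega>\<bar>) \<partial>M) = (\<integral>\<^sup>+u. ennreal (\<rho> u * student_tail p u) \<partial>\<mu>)" .
  show "integrable \<mu> (\<lambda>u. \<rho> u * student_tail p u)"
  proof (rule integrableI_nonneg)
    show "AE u in \<mu>. 0 \<le> \<rho> u * student_tail p u"
      using nonneg by (intro AE_I2) (simp only: space atLeast_iff)
    show "(\<integral>\<^sup>+u. ennreal (\<rho> u * student_tail p u) \<partial>\<mu>) < \<infinity>"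
      using fin by (simp only: eq)
  qed measurable
  \<comment> \<open>Measurability of \<open>b\<close> on the nonnegative half-line comes from the
    distribution function of \<open>?\<nu>\<close>, which is monotone on the whole line: for
    negative \<open>x\<close> the interval \<open>{0..x}\<close> is empty.\<close>
  have "mono (\<lambda>x. measure ?\<nu> {0..x})"
  proof (rule monoI)
    fix x y :: real assume "x \<le> y"
    show "measure ?\<nu> {0..x} \<le> measure ?\<nu> {0..y}"
    proof (cases "0 \<le> x")
      case True
      have "{0..y} \<in> sets \<mu>"
        by (rule Icc_sets_restrict_space[OF sets])
      with True \<open>x \<le> y\<close> have "emeasure ?\<nu> {0..x} \<le> emeasure ?\<nu> {0..y}"
        by (intro emeasure_mono) auto
      with True \<open>x \<le> y\<close> show ?thesis
        by (simp add: measure_def b b_nonneg)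
    qed simp
  qed
  then have [measurable]: "(\<lambda>x. measure ?\<nu> {0..x}) \<in> borel_measurable borel"
    by (rule borel_measurable_mono)
  have "b \<bar>x\<bar> = measure ?\<nu> {0..\<bar>x\<bar>}" for x
    by (simp add: measure_def b b_nonneg)
  then have "(\<lambda>\<omega>. b \<bar>T \<omega>\<bar>) \<in> borel_measurable M"
    by simp
  then have "(\<integral>\<omega>. b \<bar>T \<omega>\<bar> \<partial>M) = enn2real (\<integral>\<^sup>+\<omega>. ennreal (b \<bar>T \<omega>\<bar>) \<partial>M)"
    using b_nonneg by (intro integral_eq_nn_integral) auto
  also have "\<dots> = (\<integral>u. \<rho> u * student_tail p u \<partial>\<mu>)"
    unfolding eq
  proof (rule integral_eq_nn_integral[symmetric])
    show "AE u in \<mu>. 0 \<le> \<rho> u * student_tail p u"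
      using nonneg by (intro AE_I2) (simp only: space atLeast_iff)
  qed measurable
  finally show "(\<integral>\<omega>. b \<bar>T \<omega>\<bar> \<partial>M) = (\<integral>u. \<rho> u * student_tail p u \<partial>\<mu>)" .
qed

section \<open>Finiteness of moments below the degrees of freedom\<close>

text \<open>A finite \<open>r\<close> strictly between \<open>t\<close> and \<open>p\<close> gives a
  bound of the density by a multiple of \<open>x powr (- (r + 1))\<close> from 1 on, and
  \<open>t - r - 1 < -1\<close> makes the moment converge. Finite and infinite \<open>p\<close> are
  covered together.\<close>

lemma moment_finite:
  assumes "ereal t < p" "0 < t"
  shows "(\<integral>\<^sup>+\<omega>. ennreal (\<bar>T \<omega>\<bar> powr t) \<partial>M) < \<infinity>"
proof -
  obtain r where r: "t < r" "ereal r < p"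
    using ereal_dense2[OF assms(1)] by auto
  with assms have "0 < r" by simp
  \<comment> \<open>On \<open>{1..}\<close> the difference of the log kernels for \<open>p\<close>
    and \<open>r\<close> is largest at 1; \<open>K\<close> contains the exponential of this maximum.
    \<open>C\<close> adds the power of \<open>r\<close> coming from
    \<open>x\<^sup>2 / r\<close>.\<close>
  define K where "K = student_density p 0 * exp (log_kernel p 1 - log_kernel (ereal r) 1)"
  define C where "C = K * r powr ((r + 1) / 2)"
  have "0 < C"
    using student_density_pos[OF p_pos, of 0] \<open>0 < r\<close> by (simp add: C_def K_def)
  have bound: "student_density p x \<le> C * x powr (- (r + 1))" if "1 \<le> x" for x
  proof -
    have "log_kernel p (x\<^sup>2) - log_kernel (ereal r) (x\<^sup>2) \<le> log_kernel p 1 - log_kernel (ereal r) 1"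
      using log_kernel_diff_unimodal(2)[of "ereal r" p 1 "x\<^sup>2"] that r \<open>0 < r\<close>
      by (cases "x = 1") (auto simp: less_imp_le)
    then have "exp (log_kernel p (x\<^sup>2)) \<le>
        exp (log_kernel p 1 - log_kernel (ereal r) 1) * exp (log_kernel (ereal r) (x\<^sup>2))"
      by (simp flip: exp_add)
    then have "student_density p x \<le> K * exp (log_kernel (ereal r) (x\<^sup>2))"
      unfolding student_density_eq_exp_log_kernel[OF p_pos, of x] K_def
      using student_density_pos[OF p_pos, of 0] by (simp add: mult.assoc)
    also have "\<dots> = K * (1 + x\<^sup>2 / r) powr (- ((r + 1) / 2))"
    proof -
      have "log_kernel (ereal r) (x\<^sup>2) = - ((r + 1) / 2) * ln (1 + x\<^sup>2 / r)"
        by (simp add: log_kernel_def algebra_simps)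
      moreover have "0 < 1 + x\<^sup>2 / r"
        using \<open>0 < r\<close> by (intro add_pos_nonneg) auto
      ultimately show ?thesis by (simp only: powr_def) simp
    qed
    \<comment> \<open>Dropping the summand 1 enlarges the power because the exponent is
      negative.\<close>
    also have "\<dots> \<le> K * (x\<^sup>2 / r) powr (- ((r + 1) / 2))"
      using \<open>0 < r\<close> that student_density_pos[OF p_pos, of 0]
      by (intro mult_left_mono powr_mono2') (auto simp: K_def)
    also have "(x\<^sup>2 / r) powr (- ((r + 1) / 2)) = r powr ((r + 1) / 2) * x powr (- (r + 1))"
    proof -
      have "x\<^sup>2 powr (- ((r + 1) / 2)) = x powr (2 * - ((r + 1) / 2))"
        using that powr_powr[of x 2 "- ((r + 1) / 2)"] by simp
      also have "2 * - ((r + 1) / 2) = - (r + 1)" by (simp add: field_simps)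
      finally show ?thesis
        using \<open>0 < r\<close> that by (simp only: powr_divide powr_minus_divide) simp
    qed
    finally show ?thesis by (simp add: C_def mult.assoc)
  qed
  \<comment> \<open>Below 1 the factor \<open>x powr t\<close> is at most 1, so the density itself
    is a majorant; from 1 on the power bound takes over.\<close>
  have "(\<integral>\<^sup>+x. ennreal (student_density p x) * ennreal (x powr t) * indicator {0<..} x \<partial>lborel)
      \<le> (\<integral>\<^sup>+x. ennreal (student_density p x) * indicator {0<..} x
          + ennreal C * (ennreal (x powr (t - r - 1)) * indicator {1..} x) \<partial>lborel)"
  proof (intro nn_integral_mono)
    fix x :: real
    consider "x \<le> 0" | "0 < x" "x < 1" | "1 \<le> x" by linarith
    then show "ennreal (student_density p x) * ennreal (x powr t) * indicator {0<..} x
      \<le> ennreal (student_density p x) * indicator {0<..} x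
          + ennreal C * (ennreal (x powr (t - r - 1)) * indicator {1..} x)"
    proof cases
      case 2
      then have "x powr t \<le> 1" using assms by (simp add: powr_le1)
      then have "ennreal (student_density p x) * ennreal (x powr t) \<le> ennreal (student_density p x) * 1"
        by (intro mult_left_mono) auto
      with 2 show ?thesis by simp
    next
      case 3
      have "student_density p x * x powr t \<le> C * x powr (- (r + 1)) * x powr t"
        using bound[OF 3] by (intro mult_right_mono) auto
      also have "\<dots> = C * x powr (t - r - 1)"
        by (simp add: mult.assoc flip: powr_add) (simp add: algebra_simps)
      finally have "ennreal (student_density p x) * ennreal (x powr t)
          \<le> ennreal C * ennreal (x powr (t - r - 1))"
        using \<open>0 < C\<close> student_density_pos[OF p_pos, of x]
        by (simp flip: ennreal_mult add: less_imp_le)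
      with 3 show ?thesis by (auto intro: add_increasing)
    qed simp
  qed
  also have "\<dots> = (\<integral>\<^sup>+x. ennreal (student_density p x) * indicator {0<..} x \<partial>lborel)
      + ennreal C * (\<integral>\<^sup>+x. ennreal (x powr (t - r - 1)) * indicator {1..} x \<partial>lborel)"
    by (simp add: nn_integral_add nn_integral_cmult)
  also have "(\<integral>\<^sup>+x. ennreal (x powr (t - r - 1)) * indicator {1..} x \<partial>lborel)
      = ennreal (- (1 powr (t - r - 1 + 1)) / (t - r - 1 + 1))"
    using r by (intro nn_integral_has_integral_lebesgue' has_integral_powr_to_inf) auto
  finally have "(\<integral>\<^sup>+x. ennreal (student_density p x) * ennreal (x powr t) * indicator {0<..} x \<partial>lborel)
      \<noteq> \<infinity>"
    using nn_integral_student_density_half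
    by (auto simp: top_unique ennreal_mult_eq_top_iff)
  moreover have "(\<integral>\<^sup>+\<omega>. ennreal (\<bar>T \<omega>\<bar> powr t) \<partial>M) =
      2 * (\<integral>\<^sup>+x. ennreal (student_density p x) * ennreal (x powr t) * indicator {0<..} x \<partial>lborel)"
    by (rule nn_integral_abs_T) simp
  ultimately show ?thesis
    by (simp add: less_top[symmetric] ennreal_mult_eq_top_iff)
qed

end

section \<open>Monotone tail ratios and Chebyshev's association inequality\<close>

text \<open>This is \<open>tail_ratio_strict_antimono\<close> with the density for \<open>p\<close>
  as \<open>\<phi>\<close> and that for \<open>q\<close> as \<open>\<psi>\<close>; both have mass
  one half on the positive half-line.\<close>

lemma student_tail_ratio:
  assumes "student_variable M p T" "student_variable M' q T'" "p < q" "0 \<le> u" "u < v"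
  shows "student_tail q v * student_tail p u < student_tail q u * student_tail p v"
proof -
  interpret p: student_variable M p T by fact
  interpret q: student_variable M' q T' by fact
  have "(LBINT x:{0<..}. student_density p x) = (LBINT x:{0<..}. student_density q x)"
    using p.student_tail_0 q.student_tail_0 by (simp add: student_tail_def)
  then have "(LBINT x:{v<..}. student_density q x) * (LBINT x:{u<..}. student_density p x)
      < (LBINT x:{u<..}. student_density q x) * (LBINT x:{v<..}. student_density p x)"
    using assms p.p_pos student_density_pos student_density_less student_density_ratio_strict_antimono
    by (intro tail_ratio_strict_antimono p.set_integrable_student_density
        q.set_integrable_student_density) auto
  then show ?thesis by (simp add: student_tail_def)
qed

lemma integral_pos:
  fixes h :: "'a \<Rightarrow> real"
  assumes space: "space \<mu> = A" and nonzero: "emeasure \<mu> A \<noteq> 0"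
    and h: "integrable \<mu> h" and pos: "\<And>x. x \<in> A \<Longrightarrow> 0 < h x"
  shows "0 < integral\<^sup>L \<mu> h"
proof -
  have "A \<in> sets \<mu>"
    using sets.top[of \<mu>] space by simp
  moreover have "set_integrable \<mu> A h"
    unfolding set_integrable_def by (rule integrable_mult_indicator[OF \<open>A \<in> sets \<mu>\<close> h])
  ultimately have "(LINT x:A|\<mu>. 0) < (LINT x:A|\<mu>. h x)"
    using nonzero pos by (intro set_integral_strict_mono) (simp_all add: set_integrable_def)
  also have "\<dots> = integral\<^sup>L \<mu> h"
    unfolding set_lebesgue_integral_def
    by (intro Bochner_Integration.integral_cong) (simp_all add: space)
  finally show ?thesis by simp
qed

text \<open>Chebyshev's association inequality: with \<open>c = \<integral>g / \<integral>f\<close>, the function \<open>g - c f\<close> integrates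
  to \<open>0\<close> and changes sign once, at some \<open>x0\<close>, so \<open>(\<rho> - \<rho> x0) (g - c f) \<le> 0\<close> everywhere.\<close>

lemma Chebyshev_association:
  fixes \<mu> :: "real measure" and f g \<rho> :: "real \<Rightarrow> real"
  assumes space: "space \<mu> = {0..}" and nonzero: "emeasure \<mu> {0..} \<noteq> 0"
    and f_pos: "\<And>x. 0 \<le> x \<Longrightarrow> 0 < f x"
    and ratio: "\<And>x y. 0 \<le> x \<Longrightarrow> x < y \<Longrightarrow> g y * f x < g x * f y"
    and \<rho>: "mono_on {0..} \<rho>"
    and f: "integrable \<mu> f" and g: "integrable \<mu> g"
    and \<rho>f: "integrable \<mu> (\<lambda>x. \<rho> x * f x)" and \<rho>g: "integrable \<mu> (\<lambda>x. \<rho> x * g x)"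
  shows "(\<integral>x. \<rho> x * g x \<partial>\<mu>) * integral\<^sup>L \<mu> f \<le> (\<integral>x. \<rho> x * f x \<partial>\<mu>) * integral\<^sup>L \<mu> g"
    and "\<not> mu_constant_on \<mu> \<rho> {0..} \<Longrightarrow>
      (\<integral>x. \<rho> x * g x \<partial>\<mu>) * integral\<^sup>L \<mu> f < (\<integral>x. \<rho> x * f x \<partial>\<mu>) * integral\<^sup>L \<mu> g"
proof -
  note pos_integral = integral_pos[OF space nonzero]
  define c where "c = integral\<^sup>L \<mu> g / integral\<^sup>L \<mu> f"
  have If: "0 < integral\<^sup>L \<mu> f" using pos_integral[OF f] f_pos by simp
  define h where "h x = g x - c * f x" for x
  have h: "integrable \<mu> h" "integral\<^sup>L \<mu> h = 0"
    unfolding h_def using f g If by (auto simp: c_def)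
  \<comment> \<open>Multiplying \<open>c * f y \<le> g y\<close> by \<open>f x\<close> and applying
    the strict ratio inequality leaves a common positive factor \<open>f y\<close>.\<close>
  have desc: "0 < h x" if "0 \<le> x" "x < y" "0 \<le> h y" for x y
  proof -
    have "c * f y * f x \<le> g y * f x"
      using that f_pos[of x] by (intro mult_right_mono) (auto simp: h_def)
    also have "\<dots> < g x * f y" using ratio that by simp
    finally have "(c * f x) * f y < g x * f y" by (simp add: ac_simps)
    then show ?thesis using f_pos[of y] that by (simp add: h_def)
  qed
  \<comment> \<open>Because \<open>h\<close> integrates to 0 over a measure of nonzero mass, it
    cannot have one strict sign everywhere. So \<open>S\<close> is nonempty, and it is bounded,
    since otherwise \<open>desc\<close> would make \<open>h\<close> positive everywhere.\<close>
  define S where "S = {x. 0 \<le> x \<and> 0 \<le> h x}"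
  have "S \<noteq> {}"
  proof
    assume "S = {}"
    then have "0 < (\<integral>x. - h x \<partial>\<mu>)"
      using h by (intro pos_integral) (auto simp: S_def)
    then show False using h by simp
  qed
  have "bdd_above S"
  proof (rule ccontr)
    assume *: "\<not> bdd_above S"
    have "0 < h x" if "0 \<le> x" for x
    proof -
      obtain y where "y \<in> S" "x < y"
        using * by (metis bdd_aboveI not_le)
      then show ?thesis using desc that by (auto simp: S_def)
    qed
    then show False using pos_integral[OF h(1)] h(2) by auto
  qed
  \<comment> \<open>The sign of \<open>h\<close> at \<open>x0\<close> itself is left open;
    \<open>k\<close> vanishes there in any case.\<close>
  define x0 where "x0 = Sup S"
  have "0 \<le> x0"
  proof -
    obtain y where "y \<in> S" using \<open>S \<noteq> {}\<close> by blast
    then have "0 \<le> y" "y \<le> x0"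
      using cSup_upper[OF _ \<open>bdd_above S\<close>] by (auto simp: S_def x0_def)
    then show ?thesis by simp
  qed
  have below: "0 < h x" if "0 \<le> x" "x < x0" for x
  proof -
    obtain y where "y \<in> S" "x < y"
      using less_cSupD[OF \<open>S \<noteq> {}\<close>, of x] \<open>x < x0\<close> unfolding x0_def by blast
    then show ?thesis using desc[OF \<open>0 \<le> x\<close>, of y] by (simp add: S_def)
  qed
  have above: "h x < 0" if "x0 < x" for x
  proof -
    have "x \<notin> S"
      using cSup_upper[OF _ \<open>bdd_above S\<close>, of x] that by (auto simp: x0_def)
    then show ?thesis using that \<open>0 \<le> x0\<close> by (simp add: S_def)
  qed
  define k where "k x = (\<rho> x0 - \<rho> x) * h x" for x
  have k_eq: "k x = \<rho> x0 * h x - (\<rho> x * g x - c * (\<rho> x * f x))" for x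
    by (simp add: k_def h_def algebra_simps)
  have k_nonneg: "0 \<le> k x" if "0 \<le> x" for x
  proof (cases x x0 rule: linorder_cases)
    case less
    with below[of x] that mono_onD[OF \<rho>, of x x0] show ?thesis
      by (auto simp: k_def)
  next
    case greater
    with above[of x] \<open>0 \<le> x0\<close> mono_onD[OF \<rho>, of x0 x] show ?thesis
      by (auto simp: k_def intro!: mult_nonpos_nonpos)
  qed (simp add: k_def)
  have k: "integrable \<mu> k"
    unfolding k_eq using h \<rho>f \<rho>g by auto
  \<comment> \<open>The term with the constant \<open>\<rho> x0\<close> disappears because
    \<open>h\<close> integrates to 0.\<close>
  have Ik: "integral\<^sup>L \<mu> k = c * (\<integral>x. \<rho> x * f x \<partial>\<mu>) - (\<integral>x. \<rho> x * g x \<partial>\<mu>)"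
    unfolding k_eq using h \<rho>f \<rho>g by simp
  have AE_k: "AE x in \<mu>. 0 \<le> k x"
    using k_nonneg by (intro AE_I2) (simp add: space)
  have cI: "Y * integral\<^sup>L \<mu> g = (c * Y) * integral\<^sup>L \<mu> f" for Y
    using If by (simp add: c_def)
  have "0 \<le> integral\<^sup>L \<mu> k"
    by (rule integral_nonneg_AE[OF AE_k])
  then have "(\<integral>x. \<rho> x * g x \<partial>\<mu>) \<le> c * (\<integral>x. \<rho> x * f x \<partial>\<mu>)"
    unfolding Ik by linarith
  then show "(\<integral>x. \<rho> x * g x \<partial>\<mu>) * integral\<^sup>L \<mu> f \<le> (\<integral>x. \<rho> x * f x \<partial>\<mu>) * integral\<^sup>L \<mu> g"
    unfolding cI using If by (intro mult_right_mono) simp_all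
  assume nonconst: "\<not> mu_constant_on \<mu> \<rho> {0..}"
  have "integral\<^sup>L \<mu> k \<noteq> 0"
  proof
    assume "integral\<^sup>L \<mu> k = 0"
    then have "AE x in \<mu>. k x = 0"
      using integral_nonneg_eq_0_iff_AE[OF k AE_k] by blast
    \<comment> \<open>Away from \<open>x0\<close> the function \<open>h\<close> is nonzero, so a
      zero of \<open>k\<close> forces \<open>\<rho> x = \<rho> x0\<close>; this value is the
      constant contradicting \<open>nonconst\<close>.\<close>
    then have "AE x in \<mu>. \<rho> x = \<rho> x0"
    proof (rule AE_mp, intro AE_I2 impI)
      fix x assume "x \<in> space \<mu>" "k x = 0"
      then show "\<rho> x = \<rho> x0"
        using below[of x] above[of x] by (cases x x0 rule: linorder_cases) (auto simp: space k_def)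
    qed
    then obtain N where "{x \<in> space \<mu>. \<not> \<rho> x = \<rho> x0} \<subseteq> N" "emeasure \<mu> N = 0" "N \<in> sets \<mu>"
      by (rule AE_E)
    then have "emeasure \<mu> {x \<in> {0..}. \<rho> x \<noteq> \<rho> x0} = 0"
      using emeasure_mono[of "{x \<in> {0..}. \<rho> x \<noteq> \<rho> x0}" N \<mu>] by (simp add: space)
    then show False using nonconst by (auto simp: mu_constant_on_def)
  qed
  with \<open>0 \<le> integral\<^sup>L \<mu> k\<close> have "(\<integral>x. \<rho> x * g x \<partial>\<mu>) < c * (\<integral>x. \<rho> x * f x \<partial>\<mu>)"
    unfolding Ik by linarith
  then show "(\<integral>x. \<rho> x * g x \<partial>\<mu>) * integral\<^sup>L \<mu> f < (\<integral>x. \<rho> x * f x \<partial>\<mu>) * integral\<^sup>L \<mu> g"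
    unfolding cI using If by (rule mult_strict_right_mono)
qed

lemma student_expectation_ratio:
  fixes a b \<rho> :: "real \<Rightarrow> real"
  assumes p: "student_variable M p T" and q: "student_variable M' q T'" and pq: "p < q"
    and sets: "sets \<mu> = sets (restrict_space borel {0..})"
    and \<rho>: "\<rho> \<in> borel_measurable \<mu>" "\<And>x. 0 \<le> x \<Longrightarrow> 0 \<le> \<rho> x" "mono_on {0..} \<rho>"
    and a: "\<And>x. 0 \<le> x \<Longrightarrow> emeasure \<mu> {0..x} = ennreal (a x)" "\<And>x. 0 \<le> x \<Longrightarrow> 0 \<le> a x"
    and a_nonzero: "0 \<le> x1" "a x1 \<noteq> 0"
    and b: "\<And>x. 0 \<le> x \<Longrightarrow> emeasure (density \<mu> (\<lambda>x. ennreal (\<rho> x))) {0..x} = ennreal (b x)"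
      "\<And>x. 0 \<le> x \<Longrightarrow> 0 \<le> b x"
    and fin: "(\<integral>\<^sup>+\<omega>. ennreal (a \<bar>T \<omega>\<bar>) \<partial>M) < \<infinity>" "(\<integral>\<^sup>+\<omega>. ennreal (a \<bar>T' \<omega>\<bar>) \<partial>M') < \<infinity>"
      "(\<integral>\<^sup>+\<omega>. ennreal (b \<bar>T \<omega>\<bar>) \<partial>M) < \<infinity>" "(\<integral>\<^sup>+\<omega>. ennreal (b \<bar>T' \<omega>\<bar>) \<partial>M') < \<infinity>"
  shows "(\<integral>\<omega>. b \<bar>T' \<omega>\<bar> \<partial>M') / (\<integral>\<omega>. a \<bar>T' \<omega>\<bar> \<partial>M') \<le> (\<integral>\<omega>. b \<bar>T \<omega>\<bar> \<partial>M) / (\<integral>\<omega>. a \<bar>T \<omega>\<bar> \<partial>M)"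
    and "\<not> mu_constant_on \<mu> \<rho> {0..} \<Longrightarrow>
      (\<integral>\<omega>. b \<bar>T' \<omega>\<bar> \<partial>M') / (\<integral>\<omega>. a \<bar>T' \<omega>\<bar> \<partial>M') < (\<integral>\<omega>. b \<bar>T \<omega>\<bar> \<partial>M) / (\<integral>\<omega>. a \<bar>T \<omega>\<bar> \<partial>M)"
proof -
  interpret p: student_variable M p T by fact
  interpret q: student_variable M' q T' by fact
  have space: "space \<mu> = {0..}"
    using sets_eq_imp_space_eq[OF sets] by (simp add: space_restrict_space)
  \<comment> \<open>The expectation of \<open>a\<close> is the case of constant density 1 in
    \<open>expectation_layer_cake\<close>.\<close>
  have a': "emeasure (density \<mu> (\<lambda>x. ennreal 1)) {0..x} = ennreal (a x)" if "0 \<le> x" for x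
    using a(1)[OF that] by (simp add: density_1)
  have pa: "integrable \<mu> (student_tail p)" "(\<integral>\<omega>. a \<bar>T \<omega>\<bar> \<partial>M) = integral\<^sup>L \<mu> (student_tail p)"
    using p.expectation_layer_cake[OF sets _ _ a' a(2) fin(1)] by simp_all
  have qa: "integrable \<mu> (student_tail q)" "(\<integral>\<omega>. a \<bar>T' \<omega>\<bar> \<partial>M') = integral\<^sup>L \<mu> (student_tail q)"
    using q.expectation_layer_cake[OF sets _ _ a' a(2) fin(2)] by simp_all
  note pb = p.expectation_layer_cake[OF sets \<rho>(1,2) b fin(3)]
  note qb = q.expectation_layer_cake[OF sets \<rho>(1,2) b fin(4)]
  have nonzero: "emeasure \<mu> {0..} \<noteq> 0"
  proof
    assume "emeasure \<mu> {0..} = 0"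
    moreover have "emeasure \<mu> {0..x1} \<le> emeasure \<mu> {0..}"
      using sets.top[of \<mu>] by (intro emeasure_mono) (auto simp: space)
    ultimately show False
      using a(1,2)[of x1] a_nonzero by simp
  qed
  note tail_ratio = student_tail_ratio[OF p q pq]
  have pos_p: "0 < integral\<^sup>L \<mu> (student_tail p)" and pos_q: "0 < integral\<^sup>L \<mu> (student_tail q)"
    using pa(1) qa(1) p.student_tail_pos q.student_tail_pos
    by (auto intro!: integral_pos[OF space nonzero])
  \<comment> \<open>Chebyshev's inequality is used with the tail for \<open>p\<close> as
    \<open>f\<close> and the tail for \<open>q\<close> as \<open>g\<close>; positive denominators
    turn the products into quotients.\<close>
  show "(\<integral>\<omega>. b \<bar>T' \<omega>\<bar> \<partial>M') / (\<integral>\<omega>. a \<bar>T' \<omega>\<bar> \<partial>M') \<le> (\<integral>\<omega>. b \<bar>T \<omega>\<bar> \<partial>M) / (\<integral>\<omega>. a \<bar>T \<omega>\<bar> \<partial>M)"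
    using Chebyshev_association(1)[OF space nonzero p.student_tail_pos tail_ratio \<rho>(3) pa(1) qa(1) pb(1) qb(1)]
      pos_p pos_q
    by (simp only: pa(2) qa(2) pb(2) qb(2)) (simp add: frac_le_eq divide_le_eq pos_le_divide_eq mult.commute)
  show "(\<integral>\<omega>. b \<bar>T' \<omega>\<bar> \<partial>M') / (\<integral>\<omega>. a \<bar>T' \<omega>\<bar> \<partial>M') < (\<integral>\<omega>. b \<bar>T \<omega>\<bar> \<partial>M) / (\<integral>\<omega>. a \<bar>T \<omega>\<bar> \<partial>M)"
    if "\<not> mu_constant_on \<mu> \<rho> {0..}"
    using Chebyshev_association(2)[OF space nonzero p.student_tail_pos tail_ratio \<rho>(3) pa(1) qa(1) pb(1) qb(1) that]
      pos_p pos_q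
    by (simp only: pa(2) qa(2) pb(2) qb(2)) (simp add: pos_less_divide_eq pos_divide_less_eq mult.commute)
qed

section \<open>Measures of the power functions\<close>

text \<open>This is the measure with distribution function \<open>x powr s\<close>, given by its
  Lebesgue density so that integrals against it reduce to Lebesgue integrals.\<close>

definition powr_measure :: "real \<Rightarrow> real measure" where
  "powr_measure s = restrict_space (density lborel (\<lambda>u. ennreal (s * u powr (s - 1)))) {0..}"

lemma sets_powr_measure: "sets (powr_measure s) = sets (restrict_space borel {0..})"
  by (simp add: powr_measure_def sets_restrict_space)

text \<open>The two densities multiply to \<open>t * u powr (t - 1)\<close>, whose integral over
  \<open>{0..x}\<close> is \<open>x powr t\<close>. The case \<open>t = s\<close> is included and
  yields \<open>emeasure_powr_measure\<close>.\<close>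

lemma emeasure_density_powr_measure:
  assumes s: "0 < s" and t: "0 < t" and x: "0 \<le> x"
  shows "emeasure (density (powr_measure s) (\<lambda>u. ennreal (t / s * u powr (t - s)))) {0..x}
    = ennreal (x powr t)"
proof -
  have sets: "{0..x} \<in> sets (powr_measure s)"
    by (rule Icc_sets_restrict_space[OF sets_powr_measure])
  have meas: "(\<lambda>u. ennreal (t / s * u powr (t - s))) \<in> borel_measurable (powr_measure s)"
    unfolding measurable_cong_sets[OF sets_powr_measure refl]
    by (intro measurable_restrict_space1) measurable
  have "emeasure (density (powr_measure s) (\<lambda>u. ennreal (t / s * u powr (t - s)))) {0..x}
      = (\<integral>\<^sup>+u. ennreal (t / s * u powr (t - s)) * indicator {0..x} u \<partial>powr_measure s)"
    by (rule emeasure_density[OF meas sets])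
  also have "\<dots> = (\<integral>\<^sup>+u. (ennreal (t / s * u powr (t - s)) * indicator {0..x} u) * indicator {0..} u
      \<partial>density lborel (\<lambda>u. ennreal (s * u powr (s - 1))))"
    unfolding powr_measure_def by (rule nn_integral_restrict_space) simp
  also have "\<dots> = (\<integral>\<^sup>+u. ennreal (s * u powr (s - 1)) *
      ((ennreal (t / s * u powr (t - s)) * indicator {0..x} u) * indicator {0..} u) \<partial>lborel)"
    by (rule nn_integral_density) measurable
  also have "\<dots> = (\<integral>\<^sup>+u. ennreal (t * u powr (t - 1)) * indicator {0..x} u \<partial>lborel)"
  proof (intro nn_integral_cong)
    fix u :: real
    have "u powr (t - 1) = u powr (s - 1) * u powr (t - s)"
      using powr_add[of u "s - 1" "t - s"] by (simp add: algebra_simps)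
    then have "ennreal (s * u powr (s - 1)) * ennreal (t / s * u powr (t - s)) = ennreal (t * u powr (t - 1))"
      using s t by (simp flip: ennreal_mult')
    then show "ennreal (s * u powr (s - 1)) *
      ((ennreal (t / s * u powr (t - s)) * indicator {0..x} u) * indicator {0..} u)
      = ennreal (t * u powr (t - 1)) * indicator {0..x} u"
      by (auto simp: indicator_def)
  qed
  also have "\<dots> = ennreal (t * (x powr (t - 1 + 1) / (t - 1 + 1)))"
    using s t x by (intro nn_integral_has_integral_lebesgue' has_integral_mult_right
        has_integral_powr_from_0) auto
  finally show ?thesis using t by simp
qed

lemma emeasure_powr_measure:
  assumes "0 < s" "0 \<le> x"
  shows "emeasure (powr_measure s) {0..x} = ennreal (x powr s)"
proof -
  have "{0..x} \<in> sets (powr_measure s)"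
    by (rule Icc_sets_restrict_space[OF sets_powr_measure])
  moreover have "(\<lambda>u. ennreal (s / s * u powr (s - s))) \<in> borel_measurable (powr_measure s)"
    unfolding measurable_cong_sets[OF sets_powr_measure refl]
    by (intro measurable_restrict_space1) measurable
  \<comment> \<open>The density \<open>s / s * u powr (s - s)\<close> is 1 except at 0, where
    \<open>0 powr 0 = 0\<close>; that point is null.\<close>
  moreover have "AE u in powr_measure s. u \<noteq> 0"
    unfolding powr_measure_def by (subst AE_restrict_space_iff) (auto simp: AE_density)
  then have "(\<integral>\<^sup>+u. ennreal (s / s * u powr (s - s)) * indicator {0..x} u \<partial>powr_measure s) =
      (\<integral>\<^sup>+u. indicator {0..x} u \<partial>powr_measure s)"
    using assms by (intro nn_integral_cong_AE) (auto elim!: eventually_mono)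
  ultimately have "emeasure (density (powr_measure s) (\<lambda>u. ennreal (s / s * u powr (s - s)))) {0..x} =
      emeasure (powr_measure s) {0..x}"
    by (simp only: emeasure_density nn_integral_indicator)
  then show ?thesis
    using emeasure_density_powr_measure[OF assms(1,1,2)] by simp
qed

text \<open>Both \<open>{0..1}\<close> and \<open>{1<..2}\<close> have positive measure, so if
  \<open>\<rho>\<close> equalled \<open>l\<close> almost everywhere, it would take this value in
  each of them, against strict monotonicity.\<close>

lemma not_mu_constant_on_powr_measure:
  assumes "0 < s" and \<rho>: "strict_mono_on {0..} \<rho>" "\<rho> \<in> borel_measurable borel"
  shows "\<not> mu_constant_on (powr_measure s) \<rho> {0..}"
proof
  assume "mu_constant_on (powr_measure s) \<rho> {0..}"
  then obtain l where l: "emeasure (powr_measure s) {x \<in> {0..}. \<rho> x \<noteq> l} = 0"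
    by (auto simp: mu_constant_on_def)
  let ?N = "{x \<in> {0..}. \<rho> x \<noteq> l}"
  have sets: "A \<inter> {0..} \<in> sets (powr_measure s)" if "A \<in> sets borel" for A
    using that by (auto simp: sets_powr_measure sets_restrict_space)
  have "{x \<in> space borel. \<rho> x \<noteq> l} \<in> sets borel"
    using \<rho>(2) by measurable
  from sets[OF this] have N: "?N \<in> sets (powr_measure s)"
    by (simp add: Int_def conj_commute)
  have Icc: "{0..1} \<in> sets (powr_measure s)" "{1<..2} \<in> sets (powr_measure s)"
    using sets[of "{0..1}"] sets[of "{1<..2}"] by (simp_all add: Int_absorb2 subset_eq)
  have one: "emeasure (powr_measure s) {0..1} = 1"
    using emeasure_powr_measure[OF assms(1), of 1] by simp
  \<comment> \<open>Additivity shows that \<open>{1<..2}\<close> is not null: \<open>{0..1}\<close>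
    has mass 1 and \<open>{0..2}\<close> has mass \<open>2 powr s\<close>, which differs from
    1.\<close>
  have "{0..1} \<union> {1<..2} = {0..2::real}" by auto
  then have "emeasure (powr_measure s) {0..1} + emeasure (powr_measure s) {1<..2}
      = emeasure (powr_measure s) {0..2}"
    using Icc by (subst plus_emeasure) auto
  also have "\<dots> = ennreal (2 powr s)"
    using emeasure_powr_measure[OF assms(1), of 2] by simp
  also have "\<dots> \<noteq> 1"
    using assms by simp
  finally have "emeasure (powr_measure s) {1<..2} \<noteq> 0" using one by auto
  moreover have "emeasure (powr_measure s) A = 0" if "A \<subseteq> ?N" for A
    using emeasure_mono[OF that N] l by simp
  ultimately have "\<not> {0..1} \<subseteq> ?N" "\<not> {1<..2} \<subseteq> ?N" using one by force+
  then obtain x y where "0 \<le> x" "x < y" "\<rho> x = l" "\<rho> y = l" by force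
  then show False
    using strict_mono_onD[OF \<rho>(1), of x y] by auto
qed

section \<open>Stieltjes measures and power moments as instances of the comparison\<close>

theorem corollary1p3:
  fixes M :: "ereal \<Rightarrow> 'w measure" and T :: "ereal \<Rightarrow> 'w \<Rightarrow> real"
  assumes "\<And>p. 0 < p \<Longrightarrow> prob_space (M p)"
    and "\<And>p. 0 < p \<Longrightarrow> distributed (M p) lborel (T p) (\<lambda>x. ennreal (student_density p x))"
  shows
    "(\<forall>a b \<rho> :: real \<Rightarrow> real.
        a \<in> {0..} \<rightarrow> {0..} \<and> mono_on {0..} a \<and> (\<forall>x\<ge>0. continuous (at_right x) a) \<and>
        (\<exists>x\<ge>0. a x \<noteq> 0) \<and>
        b \<in> {0..} \<rightarrow> {0..} \<and> mono_on {0..} b \<and> (\<forall>x\<ge>0. continuous (at_right x) b) \<and>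
        (\<exists>x\<ge>0. b x \<noteq> 0) \<and>
        absolutely_continuous (stieltjes_measure a) (stieltjes_measure b) \<and>
        \<rho> \<in> {0..} \<rightarrow> {0..} \<and> \<rho> \<in> borel_measurable (stieltjes_measure a) \<and>
        density (stieltjes_measure a) (\<lambda>x. ennreal (\<rho> x)) = stieltjes_measure b
        \<longrightarrow>
        (let Fa = {p. 0 < p \<and> (\<integral>\<^sup>+ \<omega>. ennreal (a \<bar>T p \<omega>\<bar>) \<partial>M p) < \<infinity>};
             Fb = {p. 0 < p \<and> (\<integral>\<^sup>+ \<omega>. ennreal (b \<bar>T p \<omega>\<bar>) \<partial>M p) < \<infinity>};
             R = (\<lambda>p. (\<integral>\<omega>. b \<bar>T p \<omega>\<bar> \<partial>M p) / (\<integral>\<omega>. a \<bar>T p \<omega>\<bar> \<partial>M p))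
         in mono_on {0..} \<rho> \<longrightarrow>
              antimono_on (Fa \<inter> Fb) R \<and>
              (\<not> mu_constant_on (stieltjes_measure a) \<rho> {0..} \<longrightarrow>
                 strict_antimono_on (Fa \<inter> Fb) R))) \<and>
     (\<forall>s t :: real. 0 < s \<and> s < t \<longrightarrow>
        strict_antimono_on {ereal t<..}
          (\<lambda>p. (\<integral>\<omega>. \<bar>T p \<omega>\<bar> powr t \<partial>M p) / (\<integral>\<omega>. \<bar>T p \<omega>\<bar> powr s \<partial>M p)))"
proof -
  have sv: "student_variable (M p) p (T p)" if "0 < p" for p
    using assms that by (intro student_variable.intro student_variable_axioms.intro)
  show ?thesis
  proof (intro conjI allI impI)
    fix a b \<rho> :: "real \<Rightarrow> real"
    assume H: "a \<in> {0..} \<rightarrow> {0..} \<and> mono_on {0..} a \<and> (\<forall>x\<ge>0. continuous (at_right x) a) \<and>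
        (\<exists>x\<ge>0. a x \<noteq> 0) \<and>
        b \<in> {0..} \<rightarrow> {0..} \<and> mono_on {0..} b \<and> (\<forall>x\<ge>0. continuous (at_right x) b) \<and>
        (\<exists>x\<ge>0. b x \<noteq> 0) \<and>
        absolutely_continuous (stieltjes_measure a) (stieltjes_measure b) \<and>
        \<rho> \<in> {0..} \<rightarrow> {0..} \<and> \<rho> \<in> borel_measurable (stieltjes_measure a) \<and>
        density (stieltjes_measure a) (\<lambda>x. ennreal (\<rho> x)) = stieltjes_measure b"
    define Fa where "Fa = {p. 0 < p \<and> (\<integral>\<^sup>+ \<omega>. ennreal (a \<bar>T p \<omega>\<bar>) \<partial>M p) < \<infinity>}"
    define Fb where "Fb = {p. 0 < p \<and> (\<integral>\<^sup>+ \<omega>. ennreal (b \<bar>T p \<omega>\<bar>) \<partial>M p) < \<infinity>}"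
    define R where "R = (\<lambda>p. (\<integral>\<omega>. b \<bar>T p \<omega>\<bar> \<partial>M p) / (\<integral>\<omega>. a \<bar>T p \<omega>\<bar> \<partial>M p))"
    have a: "emeasure (stieltjes_measure a) {0..x} = ennreal (a x)" if "0 \<le> x" for x
      using H that by (intro emeasure_stieltjes_measure) auto
    have b: "emeasure (density (stieltjes_measure a) (\<lambda>x. ennreal (\<rho> x))) {0..x} = ennreal (b x)"
      if "0 \<le> x" for x
    proof -
      have "emeasure (stieltjes_measure b) {0..x} = ennreal (b x)"
        using H that by (intro emeasure_stieltjes_measure) auto
      then show ?thesis using H by simp
    qed
    have nonneg: "0 \<le> a x" "0 \<le> b x" "0 \<le> \<rho> x" if "0 \<le> x" for x
      using H that by (auto simp: Pi_iff)
    obtain x1 where x1: "0 \<le> x1" "a x1 \<noteq> 0"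
      using H by auto
    have \<rho>: "\<rho> \<in> borel_measurable (stieltjes_measure a)" using H by blast
    have R: "R q \<le> R p" "\<not> mu_constant_on (stieltjes_measure a) \<rho> {0..} \<Longrightarrow> R q < R p"
      if mono: "mono_on {0..} \<rho>" and pq: "p \<in> Fa \<inter> Fb" "q \<in> Fa \<inter> Fb" "p < q" for p q
    proof -
      have "0 < p" "0 < q"
        and fin: "(\<integral>\<^sup>+ \<omega>. ennreal (a \<bar>T p \<omega>\<bar>) \<partial>M p) < \<infinity>" "(\<integral>\<^sup>+ \<omega>. ennreal (a \<bar>T q \<omega>\<bar>) \<partial>M q) < \<infinity>"
          "(\<integral>\<^sup>+ \<omega>. ennreal (b \<bar>T p \<omega>\<bar>) \<partial>M p) < \<infinity>" "(\<integral>\<^sup>+ \<omega>. ennreal (b \<bar>T q \<omega>\<bar>) \<partial>M q) < \<infinity>"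
        using pq by (auto simp: Fa_def Fb_def)
      note ratio = student_expectation_ratio[OF sv[OF \<open>0 < p\<close>] sv[OF \<open>0 < q\<close>] \<open>p < q\<close>
          sets_stieltjes_measure \<rho> nonneg(3) mono a nonneg(1) x1 b nonneg(2) fin]
      show "R q \<le> R p" unfolding R_def by (rule ratio(1))
      show "R q < R p" if "\<not> mu_constant_on (stieltjes_measure a) \<rho> {0..}"
        unfolding R_def by (rule ratio(2)) (simp_all add: that)
    qed
    have "mono_on {0..} \<rho> \<longrightarrow> antimono_on (Fa \<inter> Fb) R \<and>
        (\<not> mu_constant_on (stieltjes_measure a) \<rho> {0..} \<longrightarrow> strict_antimono_on (Fa \<inter> Fb) R)"
    proof (intro impI conjI monotone_onI)
      \<comment> \<open>The comparison concerns \<open>p < q\<close>; for \<open>p = q\<close> the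
        inequality is an equality.\<close>
      fix p q assume "mono_on {0..} \<rho>" "p \<in> Fa \<inter> Fb" "q \<in> Fa \<inter> Fb" "p \<le> q"
      then show "R q \<le> R p"
        using R(1)[of p q] by (cases "p = q") auto
    qed (rule R(2))
    then show "let Fa = {p. 0 < p \<and> (\<integral>\<^sup>+ \<omega>. ennreal (a \<bar>T p \<omega>\<bar>) \<partial>M p) < \<infinity>};
             Fb = {p. 0 < p \<and> (\<integral>\<^sup>+ \<omega>. ennreal (b \<bar>T p \<omega>\<bar>) \<partial>M p) < \<infinity>};
             R = (\<lambda>p. (\<integral>\<omega>. b \<bar>T p \<omega>\<bar> \<partial>M p) / (\<integral>\<omega>. a \<bar>T p \<omega>\<bar> \<partial>M p))
         in mono_on {0..} \<rho> \<longrightarrow>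
              antimono_on (Fa \<inter> Fb) R \<and>
              (\<not> mu_constant_on (stieltjes_measure a) \<rho> {0..} \<longrightarrow>
                 strict_antimono_on (Fa \<inter> Fb) R)"
      unfolding Let_def Fa_def Fb_def R_def .
  next
    fix s t :: real
    assume st: "0 < s \<and> s < t"
    \<comment> \<open>This is the density of the measure of \<open>x powr t\<close> with respect to
      that of \<open>x powr s\<close>; it is strictly increasing because
      \<open>s < t\<close>.\<close>
    define \<rho> where "\<rho> u = t / s * u powr (t - s)" for u
    have strict: "strict_mono_on {0..} \<rho>"
      using st by (auto intro!: strict_mono_onI powr_less_mono2 divide_strict_right_mono simp: \<rho>_def)
    have meas: "\<rho> \<in> borel_measurable borel"
      unfolding \<rho>_def by measurable
    then have meas': "\<rho> \<in> borel_measurable (powr_measure s)"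
      unfolding measurable_cong_sets[OF sets_powr_measure refl] by (rule measurable_restrict_space1)
    have mono: "mono_on {0..} \<rho>"
      using strict by (rule strict_mono_on_imp_mono_on)
    have a: "emeasure (powr_measure s) {0..x} = ennreal (x powr s)" if "0 \<le> x" for x
      using st that by (intro emeasure_powr_measure) auto
    have b: "emeasure (density (powr_measure s) (\<lambda>x. ennreal (\<rho> x))) {0..x} = ennreal (x powr t)"
      if "0 \<le> x" for x
      unfolding \<rho>_def using st that by (intro emeasure_density_powr_measure) auto
    have nonneg: "0 \<le> \<rho> x" if "0 \<le> x" for x
      using st by (simp add: \<rho>_def)
    show "strict_antimono_on {ereal t<..}
          (\<lambda>p. (\<integral>\<omega>. \<bar>T p \<omega>\<bar> powr t \<partial>M p) / (\<integral>\<omega>. \<bar>T p \<omega>\<bar> powr s \<partial>M p))"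
    proof (rule monotone_onI)
      fix p q assume p: "p \<in> {ereal t<..}" and q: "q \<in> {ereal t<..}" and "p < q"
      \<comment> \<open>Degrees of freedom above \<open>t\<close> also exceed \<open>s\<close>, so
        both moments are finite.\<close>
      have gt: "0 < r" "ereal s < r" "ereal t < r" if "r \<in> {ereal t<..}" for r
      proof -
        show "ereal t < r" using that by simp
        moreover have "0 < ereal t" "ereal s < ereal t" using st by auto
        ultimately show "0 < r" "ereal s < r" by (blast intro: less_trans)+
      qed
      have "0 < s" "0 < t" using st by auto
      note fin = student_variable.moment_finite[OF sv[OF gt(1)[OF p]] gt(2)[OF p] \<open>0 < s\<close>]
        student_variable.moment_finite[OF sv[OF gt(1)[OF q]] gt(2)[OF q] \<open>0 < s\<close>]
        student_variable.moment_finite[OF sv[OF gt(1)[OF p]] gt(3)[OF p] \<open>0 < t\<close>]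
        student_variable.moment_finite[OF sv[OF gt(1)[OF q]] gt(3)[OF q] \<open>0 < t\<close>]
      show "(\<integral>\<omega>. \<bar>T q \<omega>\<bar> powr t \<partial>M q) / (\<integral>\<omega>. \<bar>T q \<omega>\<bar> powr s \<partial>M q)
          < (\<integral>\<omega>. \<bar>T p \<omega>\<bar> powr t \<partial>M p) / (\<integral>\<omega>. \<bar>T p \<omega>\<bar> powr s \<partial>M p)"
        \<comment> \<open>The witness 1 shows that \<open>x powr s\<close> is not identically
          zero.\<close>
        by (rule student_expectation_ratio(2)[where \<mu> = "powr_measure s" and ?x1.0 = 1,
              OF sv[OF gt(1)[OF p]] sv[OF gt(1)[OF q]] \<open>p < q\<close> sets_powr_measure meas' nonneg mono
                a powr_ge_zero _ _ b powr_ge_zero fin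
                not_mu_constant_on_powr_measure[OF \<open>0 < s\<close> strict meas]]) simp_all
    qed
  qed
qed

end
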